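(* Assume Martin's Axiom together with the negation of the Continuum Hypothesis (MA$+\neg$CH). Then each separable hereditarily supercompact regular Hausdorff space is hereditarily separable and hereditarily Lindelöf.
   Context: A topological space $X$ is supercompact if it has a subbase $\mathcal B$ of its topology such that each cover of $X$ by elements of $\mathcal B$ has a subcover consisting of at most two elements. A space is hereditarily supercompact if each of its closed subspaces is supercompact. A space is hereditarily separable (hereditarily Lindelöf) if each of its subspaces is separable (Lindelöf). *)

theory Defs
  imports "HOL-Analysis.Analysis" "HOL-Library.Equipollence"
begin

(* A subbase is a family generating the topology. As topspace (topology_generated_by \<B>) = \<Union>\<B>,
   it is in particular required to cover the space. *)
definition supercompact_space :: "'a topology \<Rightarrow> bool" where
  "supercompact_space X \<longleftrightarrow>
     (\<exists>\<B>. X = topology_generated_by \<B> \<and>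
          (\<forall>\<U>. \<U> \<subseteq> \<B> \<and> \<Union>\<U> = topspace X \<longrightarrow>
               (\<exists>\<V>. \<V> \<subseteq> \<U> \<and> finite \<V> \<and> card \<V> \<le> 2 \<and> \<Union>\<V> = topspace X)))"

(* Only closed subspaces are considered, unlike with the library's "hereditarily". *)
definition hereditarily_supercompact_space :: "'a topology \<Rightarrow> bool" where
  "hereditarily_supercompact_space X \<longleftrightarrow>
     (\<forall>F. closedin X F \<longrightarrow> supercompact_space (subtopology X F))"


(* Forcing notation: (p, q) \<in> r is read as p \<le> q ("p extends q"). *)

definition forcing_compatible :: "'p set \<Rightarrow> 'p rel \<Rightarrow> 'p \<Rightarrow> 'p \<Rightarrow> bool" where
  "forcing_compatible P r p q \<longleftrightarrow> (\<exists>s\<in>P. (s, p) \<in> r \<and> (s, q) \<in> r)"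

definition countable_chain_condition :: "'p set \<Rightarrow> 'p rel \<Rightarrow> bool" where
  "countable_chain_condition P r \<longleftrightarrow>
     (\<forall>A\<subseteq>P. (\<forall>p\<in>A. \<forall>q\<in>A. p \<noteq> q \<longrightarrow> \<not> forcing_compatible P r p q) \<longrightarrow> countable A)"

definition forcing_dense :: "'p set \<Rightarrow> 'p rel \<Rightarrow> 'p set \<Rightarrow> bool" where
  "forcing_dense P r D \<longleftrightarrow> D \<subseteq> P \<and> (\<forall>p\<in>P. \<exists>d\<in>D. (d, p) \<in> r)"

definition forcing_filter :: "'p set \<Rightarrow> 'p rel \<Rightarrow> 'p set \<Rightarrow> bool" where
  "forcing_filter P r G \<longleftrightarrow>
     G \<subseteq> P \<and> G \<noteq> {} \<and>
     (\<forall>p\<in>G. \<forall>q\<in>P. (p, q) \<in> r \<longrightarrow> q \<in> G) \<and>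
     (\<forall>p\<in>G. \<forall>q\<in>G. \<exists>s\<in>G. (s, p) \<in> r \<and> (s, q) \<in> r)"

(* Martin's Axiom for the nonempty partially ordered sets whose underlying set lives in the type 'p.
   A formula cannot quantify over all types. The instance 'p = real covers, up to isomorphism,
   exactly the posets of cardinality at most the continuum; it is a consequence of
   the axiom for all posets, hence a (formally) weaker hypothesis. *)
definition martins_axiom :: "'p itself \<Rightarrow> bool" where
  "martins_axiom (_ :: 'p itself) \<longleftrightarrow>
     (\<forall>(P :: 'p set) r \<D>.
        P \<noteq> {} \<and> partial_order_on P r \<and> countable_chain_condition P r \<and>
        \<D> \<prec> (UNIV :: real set) \<and> (\<forall>D\<in>\<D>. forcing_dense P r D) \<longrightarrow>
        (\<exists>G. forcing_filter P r G \<and> (\<forall>D\<in>\<D>. G \<inter> D \<noteq> {})))"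

definition continuum_hypothesis :: bool where
  "continuum_hypothesis \<longleftrightarrow> (\<forall>S :: real set. countable S \<or> S \<approx> (UNIV :: real set))"

end

theory Submission
  imports Defs "HOL-Library.Countable_Set_Type"
begin

text \<open>
  If a separable hereditarily supercompact space had an uncountable discrete subspace, almost
  disjoint forcing would thin out a countable dense set to a set \<open>D'\<close> accumulating at uncountably
  many of its points, with neighbourhoods of these points meeting pairwise in finite subsets of the
  closure of \<open>D'\<close>. By a variant of a theorem of Bell, such a closure is not supercompact. So all
  discrete subspaces are countable, and the rest follows Szentmiklossy: compactness then gives
  countable tightness of all finite powers, which makes the poset of finite discrete subsets of a
  right-separated sequence of length \<open>w1\<close> satisfy the countable chain condition; a generic filter
  yields an uncountable discrete set. Hence the space is hereditarily Lindelof. A left-separated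
  sequence would exhibit a nonempty open piece of a compact space with the countable chain condition
  as a union of \<open>w1\<close> nowhere dense sets, which Martin's axiom excludes.
\<close>

text \<open>The hypothesis speaks of posets whose carrier is a set of reals, and of fewer than
  continuum many dense sets. The negation of CH enters as \<open>w1\<close> lying strictly below the
  continuum, so that dense sets indexed by \<open>w1\<close> can all be met. The bound on the
  carrier forces every poset to be counted: finite sets of reals are coded by rational intervals,
  and the last poset is made of regular open sets coming from a countable dense set. Separability
  thus serves twice, for that small base and for the countable set that is thinned out.
  Supercompactness also enters twice: for the whole space, where it gives compactness, and for
  closures of countable sets, where it bounds almost disjoint families. The obstacle in the second
  use is that neighbourhoods isolating the points of a discrete subspace may still overlap in large
  sets; the forcing is there to make the overlaps finite. Finite sets of indices are treated as
  single points of finite powers of the space, which is why tightness is needed for the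
  powers.\<close>

unbundle cardinal_syntax

section \<open>The first uncountable ordinal\<close>

text \<open>The ordinal \<omega>_1 as a type of its own: class \<open>wellorder\<close> then
  supplies intervals, \<open>LEAST\<close> and well-founded recursion for the transfinite
  constructions.\<close>

typedef w1 = "Field (cardSuc natLeq)"
proof -
  have "\<not> finite (Field (cardSuc natLeq))"
    using cardSuc_finite[OF natLeq_Card_order] by (simp add: Field_natLeq)
  then show ?thesis
    using infinite_imp_nonempty by blast
qed

lemma Well_order_cardSuc_natLeq: "Well_order (cardSuc natLeq)"
  by (simp add: card_order_on_well_order_on cardSuc_Card_order natLeq_Card_order)

instantiation w1 :: wellorder
begin

definition less_eq_w1 :: "w1 \<Rightarrow> w1 \<Rightarrow> bool" where
  "less_eq_w1 a b \<longleftrightarrow> (Rep_w1 a, Rep_w1 b) \<in> cardSuc natLeq"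

definition less_w1 :: "w1 \<Rightarrow> w1 \<Rightarrow> bool" where
  "less_w1 a b \<longleftrightarrow> a \<le> b \<and> a \<noteq> b"

instance
proof
  fix a b c :: w1 and P :: "w1 \<Rightarrow> bool"
  note WO = Well_order_cardSuc_natLeq[unfolded well_order_on_def linear_order_on_def
      partial_order_on_def preorder_on_def]
  show le_refl: "a \<le> a"
    using WO Rep_w1 by (auto simp: less_eq_w1_def refl_on_def)
  show "a \<le> b \<Longrightarrow> b \<le> c \<Longrightarrow> a \<le> c"
    using WO by (auto simp: less_eq_w1_def trans_def)
  show antisym: "a \<le> b \<Longrightarrow> b \<le> a \<Longrightarrow> a = b"
    using WO by (auto simp: less_eq_w1_def antisym_def simp flip: Rep_w1_inject)
  show "(a < b) = (a \<le> b \<and> \<not> b \<le> a)"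
    using antisym le_refl by (auto simp: less_w1_def)
  show "a \<le> b \<or> b \<le> a"
  proof (cases "a = b")
    case False
    then have "Rep_w1 a \<noteq> Rep_w1 b"
      by (simp add: Rep_w1_inject)
    then show ?thesis
      using WO Rep_w1[of a] Rep_w1[of b] unfolding less_eq_w1_def total_on_def by blast
  next
    case True
    then show ?thesis
      using Rep_w1 WO unfolding less_eq_w1_def refl_on_def by blast
  qed
  show "P a" if step: "\<And>x. (\<And>y. y < x \<Longrightarrow> P y) \<Longrightarrow> P x"
  proof -
    have wf: "wf (cardSuc natLeq - Id)"
      using WO by blast
    have "{(x, y). x < y} \<subseteq> inv_image (cardSuc natLeq - Id) Rep_w1"
      by (auto simp: less_w1_def less_eq_w1_def Rep_w1_inject)
    then have "wf {(x :: w1, y). x < y}"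
      using wf wf_inv_image wf_subset by blast
    then show ?thesis
    proof (induction a rule: wf_induct_rule)
      case (less x)
      then show ?case
        using step[of x] by blast
    qed
  qed
qed

end

lemma uncountable_UNIV_w1: "uncountable (UNIV :: w1 set)"
proof
  assume "countable (UNIV :: w1 set)"
  then have "countable (Rep_w1 ` UNIV)"
    by blast
  then have "countable (Field (cardSuc natLeq))"
    using type_definition.Rep_range[OF type_definition_w1] by simp
  then have "|Field (cardSuc natLeq)| \<le>o natLeq"
    by (simp add: countable_card_le_natLeq)
  then have "cardSuc natLeq \<le>o natLeq"
    using card_of_Field_ordIso[OF cardSuc_Card_order[OF natLeq_Card_order]]
      ordIso_ordLeq_trans ordIso_symmetric by blast
  then show False
    using cardSuc_greater[OF natLeq_Card_order] not_ordLess_ordLeq by blast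
qed

lemma countable_lessThan_w1: "countable {..<a :: w1}"
proof -
  have "Rep_w1 ` {..<a} \<subseteq> underS (cardSuc natLeq) (Rep_w1 a)"
    by (auto simp: underS_def less_w1_def less_eq_w1_def Rep_w1_inject)
  moreover have "|underS (cardSuc natLeq) (Rep_w1 a)| <o cardSuc natLeq"
    using card_of_underS[OF cardSuc_Card_order[OF natLeq_Card_order]] Rep_w1 by blast
  then have "countable (underS (cardSuc natLeq) (Rep_w1 a))"
    by (simp add: countable_card_le_natLeq cardSuc_ordLeq_ordLess natLeq_Card_order
        card_of_Card_order)
  ultimately have "countable (Rep_w1 ` {..<a})"
    using countable_subset by blast
  then show ?thesis
    by (rule countable_image_inj_on) (simp add: inj_on_def Rep_w1_inject)
qed

text \<open>Regularity of \<omega>_1: countably many closed initial segments, each countable, do not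
  exhaust the type.\<close>

lemma countable_bounded_w1:
  assumes "countable (C :: w1 set)"
  obtains b where "\<And>c. c \<in> C \<Longrightarrow> c < b"
proof -
  have "countable (\<Union>c\<in>C. insert c {..<c})"
    using assms countable_lessThan_w1 by blast
  then obtain b where "b \<notin> (\<Union>c\<in>C. insert c {..<c})"
    using uncountable_UNIV_w1 by (metis UNIV_eq_I)
  then have "\<And>c. c \<in> C \<Longrightarrow> c < b"
    by auto
  then show thesis
    using that by blast
qed

text \<open>The successor cardinal of \<open>natLeq\<close> is the least cardinal above it. This
  lets an uncountable discrete set be indexed by \<open>w1\<close>.\<close>

lemma w1_lepoll_uncountable:
  assumes "uncountable A"
  shows "(UNIV :: w1 set) \<lesssim> A"
proof -
  have "natLeq <o |A|"
    using assms countable_card_le_natLeq natLeq_Well_order card_of_Well_order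
      not_ordLeq_iff_ordLess by blast
  then have "cardSuc natLeq \<le>o |A|"
    by (simp add: cardSuc_ordLess_ordLeq natLeq_Card_order card_of_Card_order)
  then have "|Field (cardSuc natLeq)| \<le>o |A|"
    using card_of_Field_ordIso[OF cardSuc_Card_order[OF natLeq_Card_order]]
      ordIso_ordLeq_trans by blast
  then obtain f where f: "inj_on f (Field (cardSuc natLeq))" "f ` Field (cardSuc natLeq) \<subseteq> A"
    unfolding card_of_ordLeq[symmetric] by blast
  have "inj (f \<circ> Rep_w1)"
    using f(1) Rep_w1 by (auto simp: inj_on_def simp flip: Rep_w1_inject)
  moreover have "range (f \<circ> Rep_w1) \<subseteq> A"
    using f(2) Rep_w1 by auto
  ultimately show ?thesis
    unfolding lepoll_def by blast
qed

lemma uncountable_unbounded_w1: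
  assumes "uncountable (B :: w1 set)"
  obtains b where "b \<in> B" "a < b"
proof -
  have "\<not> B \<subseteq> insert a {..<a}"
    using assms countable_subset[of B "insert a {..<a}"] countable_lessThan_w1 by auto
  then obtain b where "b \<in> B" "b \<notin> insert a {..<a}"
    by blast
  then have "a < b"
    by auto
  then show thesis
    using that \<open>b \<in> B\<close> by blast
qed

section \<open>Martin's axiom for posets of size at most the continuum\<close>

lemma times_lepoll_reals:
  assumes "A \<lesssim> (UNIV :: real set)" "B \<lesssim> (UNIV :: real set)"
  shows "A \<times> B \<lesssim> (UNIV :: real set)"
proof -
  have "(UNIV :: real set) \<times> (UNIV :: real set) \<approx> (UNIV :: real set)"
    unfolding eqpoll_iff_card_of_ordIso
    by (rule card_of_Times_infinite_simps) (auto simp: infinite_UNIV_char_0 ordLeq_reflexive card_of_Well_order)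
  then show ?thesis
    using times_lepoll_mono[OF assms] lepoll_trans2 by blast
qed

lemma Pow_countable_lepoll_reals:
  assumes "countable D"
  shows "Pow D \<lesssim> (UNIV :: real set)"
proof -
  obtain f :: "'a \<Rightarrow> nat" where "inj_on f D"
    using assms by blast
  then have "inj_on ((`) f) (Pow D)"
    by (rule inj_on_image_Pow)
  then have "Pow D \<lesssim> (UNIV :: nat set set)"
    unfolding lepoll_def by blast
  then show ?thesis
    using nat_sets_eqpoll_reals lepoll_trans2 by blast
qed

text \<open>A finite set of reals is coded by the pairs of rationals whose open interval meets it. A
  point outside a finite set has such an interval missing that set, so the code is injective, and it
  is a subset of a countable set.\<close>

lemma Fpow_lepoll_reals:
  assumes "A \<lesssim> (UNIV :: real set)"
  shows "Fpow A \<lesssim> (UNIV :: real set)"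
proof -
  obtain f :: "'a \<Rightarrow> real" where f: "inj_on f A"
    using assms unfolding lepoll_def by blast
  have image_f: "inj_on ((`) f) (Fpow A)"
    by (rule inj_on_subset[OF inj_on_image_Pow[OF f]]) (simp add: Fpow_subset_Pow)
  define h :: "real set \<Rightarrow> (rat \<times> rat) set"
    where "h F = {(p, q). \<exists>x\<in>F. of_rat p < x \<and> x < of_rat q}" for F
  have sub: "F \<subseteq> F'" if "finite F'" "h F = h F'" for F F'
  proof
    fix x
    assume "x \<in> F"
    show "x \<in> F'"
    proof (rule ccontr)
      assume "x \<notin> F'"
      obtain e where "e > 0" and e: "\<And>y. y \<in> F' \<Longrightarrow> y \<noteq> x \<Longrightarrow> e \<le> dist x y"
        using finite_set_avoid[OF \<open>finite F'\<close>, of x] by auto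
      obtain p q where "x - e < of_rat p" "of_rat p < x" "x < of_rat q" "of_rat q < x + e"
        using of_rat_dense[of "x - e" x] of_rat_dense[of x "x + e"] \<open>e > 0\<close> by auto
      then have "(p, q) \<in> h F" "(p, q) \<notin> h F'"
        using \<open>x \<in> F\<close> \<open>x \<notin> F'\<close> e by (auto simp: h_def dist_real_def) (smt (verit))
      then show False
        using that(2) by simp
    qed
  qed
  have "inj_on h (Fpow UNIV)"
    unfolding inj_on_def Fpow_def using sub by blast
  then have "inj_on (h \<circ> (`) f) (Fpow A)"
    by (intro comp_inj_on image_f inj_on_subset[where B = "(`) f ` Fpow A"])
      (auto simp: Fpow_def)
  then have "Fpow A \<lesssim> Pow (UNIV :: (rat \<times> rat) set)"
    unfolding lepoll_def by auto
  also have "\<dots> \<lesssim> (UNIV :: real set)"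
    by (rule Pow_countable_lepoll_reals) simp
  finally show ?thesis .
qed

text \<open>The working form of the axiom: an injection \<open>h\<close> moves a poset on any type
  into the reals, and the generic filter is pulled back. Dense sets come as an indexed family, so
  that only the size of the index set has to be estimated.\<close>

lemma martins_axiom_generic:
  fixes P :: "'p set" and E :: "'i \<Rightarrow> 'p set"
  assumes MA: "martins_axiom TYPE(real)"
    and "P \<noteq> {}" and po: "partial_order_on P r" and ccc: "countable_chain_condition P r"
    and size: "P \<lesssim> (UNIV :: real set)" and I: "I \<prec> (UNIV :: real set)"
    and dense: "\<And>i. i \<in> I \<Longrightarrow> forcing_dense P r (E i)"
  obtains G where "forcing_filter P r G" "\<And>i. i \<in> I \<Longrightarrow> G \<inter> E i \<noteq> {}"
proof -
  obtain h :: "'p \<Rightarrow> real" where h: "inj_on h P"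
    using size unfolding lepoll_def by blast
  define r' where "r' = {(h p, h q) |p q. (p, q) \<in> r}"
  have rP: "r \<subseteq> P \<times> P"
    using po by (simp add: partial_order_on_def preorder_on_def)
  have r'_iff: "(h p, h q) \<in> r' \<longleftrightarrow> (p, q) \<in> r" if "p \<in> P" "q \<in> P" for p q
    using that rP h unfolding r'_def inj_on_def by blast
  have compat: "forcing_compatible (h ` P) r' (h p) (h q) \<longleftrightarrow> forcing_compatible P r p q"
    if "p \<in> P" "q \<in> P" for p q
    unfolding forcing_compatible_def using that r'_iff by blast
  have "partial_order_on (h ` P) r'"
    unfolding partial_order_on_def preorder_on_def
  proof (intro conjI)
    show "r' \<subseteq> h ` P \<times> h ` P"
      using rP by (auto simp: r'_def)
    show "antisym r'"
    proof (rule antisymI)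
      fix x y
      assume "(x, y) \<in> r'" "(y, x) \<in> r'"
      moreover from this obtain p q where "x = h p" "y = h q" "(p, q) \<in> r"
        by (auto simp: r'_def)
      moreover have "p \<in> P" "q \<in> P"
        using rP \<open>(p, q) \<in> r\<close> by auto
      ultimately have "(q, p) \<in> r"
        using r'_iff by auto
      then show "x = y"
        using po \<open>(p, q) \<in> r\<close> \<open>x = h p\<close> \<open>y = h q\<close>
        unfolding partial_order_on_def antisym_def by blast
    qed
    show "trans r'"
    proof (rule transI)
      fix x y z
      assume "(x, y) \<in> r'" "(y, z) \<in> r'"
      moreover from this obtain p q s where "x = h p" "y = h q" "(p, q) \<in> r" "z = h s" "s \<in> P"
        using rP by (auto simp: r'_def)
      moreover have "p \<in> P" "q \<in> P"
        using rP \<open>(p, q) \<in> r\<close> by auto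
      ultimately have "(p, q) \<in> r" "(q, s) \<in> r"
        using r'_iff by auto
      then have "(p, s) \<in> r"
        using po unfolding partial_order_on_def preorder_on_def by (blast dest: transD)
      then show "(x, z) \<in> r'"
        using r'_iff \<open>p \<in> P\<close> \<open>s \<in> P\<close> \<open>x = h p\<close> \<open>z = h s\<close> by simp
    qed
    show "refl_on (h ` P) r'"
      using po unfolding partial_order_on_def preorder_on_def refl_on_def r'_def by blast
  qed
  moreover have "countable_chain_condition (h ` P) r'"
    unfolding countable_chain_condition_def
  proof (intro allI impI)
    fix A
    assume A: "A \<subseteq> h ` P"
      and anti: "\<forall>p\<in>A. \<forall>q\<in>A. p \<noteq> q \<longrightarrow> \<not> forcing_compatible (h ` P) r' p q"
    obtain B where B: "B \<subseteq> P" "A = h ` B"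
      using A by (metis subset_imageE)
    have "\<forall>p\<in>B. \<forall>q\<in>B. p \<noteq> q \<longrightarrow> \<not> forcing_compatible P r p q"
      using anti B compat h unfolding inj_on_def by (metis (no_types, lifting) image_eqI subsetD)
    then show "countable A"
      using ccc B unfolding countable_chain_condition_def by blast
  qed
  moreover have "(\<lambda>i. h ` E i) ` I \<prec> (UNIV :: real set)"
    using I image_lepoll lesspoll_trans1 by blast
  moreover have "\<forall>D\<in>(\<lambda>i. h ` E i) ` I. forcing_dense (h ` P) r' D"
    using dense unfolding forcing_dense_def r'_def by blast
  moreover have "h ` P \<noteq> {}"
    using \<open>P \<noteq> {}\<close> by simp
  ultimately have "\<exists>G. forcing_filter (h ` P) r' G \<and> (\<forall>D\<in>(\<lambda>i. h ` E i) ` I. G \<inter> D \<noteq> {})"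
    by (intro MA[unfolded martins_axiom_def, THEN spec[of _ "h ` P"], THEN spec[of _ r'],
          THEN spec[of _ "(\<lambda>i. h ` E i) ` I"], THEN mp] conjI)
  then obtain G' where G': "forcing_filter (h ` P) r' G'"
      "\<And>i. i \<in> I \<Longrightarrow> G' \<inter> h ` E i \<noteq> {}"
    by auto
  define G where "G = {p \<in> P. h p \<in> G'}"
  have G'_eq: "G' = h ` G"
    using G'(1) by (auto simp: G_def forcing_filter_def)
  have "forcing_filter P r G"
    unfolding forcing_filter_def
  proof (intro conjI ballI impI)
    show "G \<subseteq> P"
      by (auto simp: G_def)
    show "G \<noteq> {}"
      using G'(1) by (auto simp: G'_eq forcing_filter_def)
    show "q \<in> G" if "p \<in> G" "q \<in> P" "(p, q) \<in> r" for p q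
      using that G'(1) r'_iff by (auto simp: G_def forcing_filter_def)
    show "\<exists>s\<in>G. (s, p) \<in> r \<and> (s, q) \<in> r" if "p \<in> G" "q \<in> G" for p q
    proof -
      have "\<exists>s\<in>h ` G. (s, h p) \<in> r' \<and> (s, h q) \<in> r'"
        using that G'(1) unfolding forcing_filter_def G'_eq by simp
      then obtain s where "s \<in> G" "(h s, h p) \<in> r'" "(h s, h q) \<in> r'"
        by auto
      moreover have "p \<in> P" "q \<in> P" "s \<in> P"
        using that \<open>s \<in> G\<close> by (auto simp: G_def)
      ultimately show ?thesis
        using r'_iff by blast
    qed
  qed
  moreover have "G \<inter> E i \<noteq> {}" if "i \<in> I" for i
  proof -
    obtain p e where "p \<in> G" "h p = h e" "e \<in> E i"
      using G'(2)[OF \<open>i \<in> I\<close>] by (auto simp: G'_eq)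
    moreover have "e \<in> P" "p \<in> P"
      using \<open>e \<in> E i\<close> \<open>p \<in> G\<close> dense[OF \<open>i \<in> I\<close>] by (auto simp: forcing_dense_def G_def)
    ultimately show ?thesis
      using h by (auto simp: inj_on_def)
  qed
  ultimately show thesis
    using that by blast
qed

text \<open>A counterexample \<open>S\<close> to CH is uncountable and strictly below the continuum,
  and \<open>w1\<close> embeds into it.\<close>

lemma w1_lesspoll_reals:
  assumes "\<not> continuum_hypothesis"
  shows "(UNIV :: w1 set) \<prec> (UNIV :: real set)"
proof -
  obtain S :: "real set" where "uncountable S" "\<not> S \<approx> (UNIV :: real set)"
    using assms unfolding continuum_hypothesis_def by blast
  then have "S \<prec> (UNIV :: real set)"
    by (meson lepoll_iff_leqpoll subset_UNIV subset_imp_lepoll)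
  then show ?thesis
    using w1_lepoll_uncountable[OF \<open>uncountable S\<close>] lesspoll_trans1 by blast
qed

text \<open>Almost disjoint forcing has one dense set for each neighbourhood and each number of
  points wanted in it.\<close>

lemma w1_times_nat_lesspoll_reals:
  assumes "\<not> continuum_hypothesis"
  shows "(UNIV :: (w1 \<times> nat) set) \<prec> (UNIV :: real set)"
proof -
  have inf: "infinite (UNIV :: w1 set)"
    using uncountable_UNIV_w1 uncountable_infinite by blast
  then have "(UNIV :: nat set) \<lesssim> (UNIV :: w1 set)"
    by (simp add: infinite_le_lepoll)
  then have "|UNIV :: nat set| \<le>o |UNIV :: w1 set|"
    unfolding lepoll_def card_of_ordLeq[symmetric] .
  then have "(UNIV :: w1 set) \<times> (UNIV :: nat set) \<approx> (UNIV :: w1 set)"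
    unfolding eqpoll_iff_card_of_ordIso by (intro card_of_Times_infinite_simps inf) auto
  then show ?thesis
    using w1_lesspoll_reals[OF assms] eq_lesspoll_trans by (metis UNIV_Times_UNIV)
qed

unbundle no cardinal_syntax

section \<open>Supercompact spaces\<close>

lemma uncountable_pigeonhole:
  assumes "uncountable A" "countable C" "\<And>a. a \<in> A \<Longrightarrow> f a \<in> C"
  shows "\<exists>c\<in>C. uncountable {a \<in> A. f a = c}"
proof (rule ccontr)
  assume "\<not> ?thesis"
  then have "countable (\<Union>c\<in>C. {a \<in> A. f a = c})"
    using assms(2) by simp
  moreover have "A = (\<Union>c\<in>C. {a \<in> A. f a = c})"
    using assms(3) by auto
  ultimately show False
    using assms(1) by simp
qed

text \<open>The trace on \<open>\<Union>\<B>\<close> allows for an empty \<open>\<W>\<close>, whose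
  intersection is \<open>UNIV\<close>.\<close>

lemma generate_topology_on_nbhd:
  assumes "generate_topology_on \<B> U" "x \<in> U"
  shows "\<exists>\<W>. finite \<W> \<and> \<W> \<subseteq> \<B> \<and> x \<in> \<Inter>\<W> \<and> \<Inter>\<W> \<inter> \<Union>\<B> \<subseteq> U"
  using assms
proof (induction arbitrary: x rule: generate_topology_on.induct)
  case Empty
  then show ?case by simp
next
  case (Int a b)
  obtain \<W>1 where 1: "finite \<W>1 \<and> \<W>1 \<subseteq> \<B> \<and> x \<in> \<Inter>\<W>1 \<and> \<Inter>\<W>1 \<inter> \<Union>\<B> \<subseteq> a"
    using Int.IH(1)[of x] Int.prems by auto
  obtain \<W>2 where 2: "finite \<W>2 \<and> \<W>2 \<subseteq> \<B> \<and> x \<in> \<Inter>\<W>2 \<and> \<Inter>\<W>2 \<inter> \<Union>\<B> \<subseteq> b"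
    using Int.IH(2)[of x] Int.prems by auto
  show ?case
    by (rule exI[of _ "\<W>1 \<union> \<W>2"]) (use 1 2 in auto)
next
  case (UN K)
  then obtain k where "k \<in> K" "x \<in> k"
    by blast
  then obtain \<W> where "finite \<W> \<and> \<W> \<subseteq> \<B> \<and> x \<in> \<Inter>\<W> \<and> \<Inter>\<W> \<inter> \<Union>\<B> \<subseteq> k"
    using UN.IH[of k x] by auto
  then show ?case
    using \<open>k \<in> K\<close> by (intro exI[of _ \<W>]) auto
next
  case (Basis s)
  then show ?case
    by (intro exI[of _ "{s}"]) auto
qed

lemma supercompact_spaceE:
  assumes "supercompact_space Y"
  obtains \<B> where "Y = topology_generated_by \<B>"
    and "\<forall>\<U>. \<U> \<subseteq> \<B> \<and> \<Union>\<U> = topspace Y \<longrightarrow>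
      (\<exists>\<V>. \<V> \<subseteq> \<U> \<and> finite \<V> \<and> card \<V> \<le> 2 \<and> \<Union>\<V> = topspace Y)"
  using assms unfolding supercompact_space_def by (elim exE conjE)

text \<open>Two-element subcovers are finite, so Alexander's subbase theorem applies. The work lies
  in matching \<open>topology_generated_by\<close> with the relativized form of a subbase that this
  theorem expects.\<close>

lemma supercompact_imp_compact_space:
  assumes "supercompact_space Y"
  shows "compact_space Y"
proof -
  obtain \<B> where Y: "Y = topology_generated_by \<B>"
    and sub: "\<forall>\<U>. \<U> \<subseteq> \<B> \<and> \<Union>\<U> = topspace Y \<longrightarrow>
      (\<exists>\<V>. \<V> \<subseteq> \<U> \<and> finite \<V> \<and> card \<V> \<le> 2 \<and> \<Union>\<V> = topspace Y)"
    by (rule supercompact_spaceE[OF assms])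
  show ?thesis
  proof (rule Alexander_subbase)
    show "topology (arbitrary union_of (finite intersection_of (\<lambda>x. x \<in> \<B>) relative_to \<Union>\<B>)) = Y"
      (is "?T = Y")
    proof (rule topology_eq[THEN iffD2], intro allI iffI)
      fix S
      show "openin Y S" if "openin ?T S"
      proof (rule minimal_topology_subbase[OF _ _ that])
        show "openin Y B" if "B \<in> \<B>" for B
          unfolding Y by (rule topology_generated_by_Basis[OF that])
        show "openin Y (\<Union>\<B>)"
          unfolding Y by (metis openin_topspace topology_generated_by_topspace)
      qed
      show "openin ?T S" if "openin Y S"
      proof -
        have "generate_topology_on \<B> S"
          using that unfolding Y by (rule openin_topology_generated_by)
        then show ?thesis
        proof (induction rule: generate_topology_on.induct)
          case (Basis s)
          have "(finite intersection_of (\<lambda>x. x \<in> \<B>) relative_to \<Union>\<B>) s"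
            using Basis finite_intersection_of_inc[of "\<lambda>x. x \<in> \<B>" s]
            by (metis Union_upper inf.absorb_iff2 relative_to_inc)
          then show ?case
            unfolding openin_subbase by (rule arbitrary_union_of_inc)
        qed (auto intro: openin_Int openin_Union)
      qed
    qed
    show "\<exists>C'. finite C' \<and> C' \<subseteq> C \<and> \<Union>C' = topspace Y" if "C \<subseteq> \<B>" "\<Union>C = topspace Y" for C
      using sub[THEN spec, of C] that by auto
  qed
qed

text \<open>\<open>\<C>\<close> consists of the finite intersections of complements of members of a subbase.\<close>

lemma supercompact_space_closed_family:
  assumes "supercompact_space Y"
  shows "\<exists>\<C>. (\<forall>C\<in>\<C>. closedin Y C) \<and>
    (\<forall>\<L>\<subseteq>\<C>. \<L> \<noteq> {} \<and> (\<forall>A\<in>\<L>. \<forall>B\<in>\<L>. A \<inter> B \<noteq> {}) \<longrightarrow> \<Inter>\<L> \<noteq> {}) \<and>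
    (\<forall>K U. closedin Y K \<and> openin Y U \<and> K \<subseteq> U \<longrightarrow>
      (\<exists>\<F>. finite \<F> \<and> \<F> \<subseteq> \<C> \<and> K \<subseteq> \<Union>\<F> \<and> \<Union>\<F> \<subseteq> U))"
proof -
  obtain \<B> where Y: "Y = topology_generated_by \<B>"
    and sub: "\<forall>\<U>. \<U> \<subseteq> \<B> \<and> \<Union>\<U> = topspace Y \<longrightarrow>
      (\<exists>\<V>. \<V> \<subseteq> \<U> \<and> finite \<V> \<and> card \<V> \<le> 2 \<and> \<Union>\<V> = topspace Y)"
    by (rule supercompact_spaceE[OF assms])
  have top: "topspace Y = \<Union>\<B>"
    unfolding Y by simp
  have openB: "openin Y B" if "B \<in> \<B>" for B
    unfolding Y by (rule topology_generated_by_Basis[OF that])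
  define \<C> where "\<C> = (\<lambda>\<W>. topspace Y - \<Union>\<W>) ` {\<W>. finite \<W> \<and> \<W> \<subseteq> \<B>}"
  have "closedin Y C" if "C \<in> \<C>" for C
    using that openB unfolding \<C>_def by (auto intro!: closedin_diff openin_Union)
  moreover have "\<Inter>\<L> \<noteq> {}" if "\<L> \<subseteq> \<C>" "\<L> \<noteq> {}"
    and linked: "\<And>A B. A \<in> \<L> \<Longrightarrow> B \<in> \<L> \<Longrightarrow> A \<inter> B \<noteq> {}" for \<L>
  proof
    assume "\<Inter>\<L> = {}"
    have "\<forall>C\<in>\<L>. \<exists>\<W>. \<W> \<subseteq> \<B> \<and> C = topspace Y - \<Union>\<W>"
      using \<open>\<L> \<subseteq> \<C>\<close> unfolding \<C>_def by blast
    then obtain \<W> where \<W>: "\<And>C. C \<in> \<L> \<Longrightarrow> \<W> C \<subseteq> \<B>" "\<And>C. C \<in> \<L> \<Longrightarrow> C = topspace Y - \<Union>(\<W> C)"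
      by metis
    let ?\<U> = "\<Union>C\<in>\<L>. \<W> C"
    have "?\<U> \<subseteq> \<B>"
      using \<W>(1) by blast
    moreover have "\<Union>?\<U> = topspace Y"
    proof
      show "\<Union>?\<U> \<subseteq> topspace Y"
        using \<open>?\<U> \<subseteq> \<B>\<close> top by blast
      show "topspace Y \<subseteq> \<Union>?\<U>"
      proof
        fix x
        assume "x \<in> topspace Y"
        obtain C where "C \<in> \<L>" "x \<notin> C"
          using \<open>\<Inter>\<L> = {}\<close> by blast
        then show "x \<in> \<Union>?\<U>"
          using \<W>(2)[OF \<open>C \<in> \<L>\<close>] \<open>x \<in> topspace Y\<close> by blast
      qed
    qed
    ultimately obtain \<V> where \<V>: "\<V> \<subseteq> ?\<U>" "finite \<V>" "card \<V> \<le> 2" "\<Union>\<V> = topspace Y"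
      using sub[THEN spec, of ?\<U>] by auto
    obtain C0 where "C0 \<in> \<L>"
      using \<open>\<L> \<noteq> {}\<close> by blast
    \<comment> \<open>This is where the number two matters: each of the at most two members of
      \<open>\<V>\<close> comes from one member of \<open>\<L>\<close>, so some \<open>A\<close> and
      \<open>B\<close> account for all of \<open>\<V>\<close>. Then \<open>A \<inter> B\<close>
      misses \<open>\<Union>\<V>\<close>, the whole space, although \<open>\<L>\<close> is
      linked.\<close>
    have "\<exists>A\<in>\<L>. \<exists>B\<in>\<L>. \<V> \<subseteq> \<W> A \<union> \<W> B"
    proof -
      consider "card \<V> = 0" | "card \<V> = 1" | "card \<V> = 2"
        using \<V>(3) by linarith
      then show ?thesis
      proof cases
        case 1
        then show ?thesis
          using \<V>(2) \<open>C0 \<in> \<L>\<close> by auto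
      next
        case 2
        then obtain V where "\<V> = {V}"
          by (rule card_1_singletonE)
        then show ?thesis
          using \<V>(1) by blast
      next
        case 3
        then obtain V V' where "\<V> = {V, V'}"
          by (auto simp: card_2_iff)
        moreover from this obtain A B where "A \<in> \<L>" "V \<in> \<W> A" "B \<in> \<L>" "V' \<in> \<W> B"
          using \<V>(1) by auto
        ultimately show ?thesis
          by (intro bexI[of _ A] bexI[of _ B]) auto
      qed
    qed
    then obtain A B where AB: "A \<in> \<L>" "B \<in> \<L>" "\<V> \<subseteq> \<W> A \<union> \<W> B"
      by blast
    obtain x where "x \<in> A" "x \<in> B"
      using linked[OF AB(1,2)] by blast
    then have "x \<in> \<Union>\<V>"
      using \<W>(2)[OF AB(1)] \<V>(4) by blast
    then show False
      using AB(3) \<W>(2)[OF AB(1)] \<W>(2)[OF AB(2)] \<open>x \<in> A\<close> \<open>x \<in> B\<close> by blast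
  qed
  moreover have "\<exists>\<F>. finite \<F> \<and> \<F> \<subseteq> \<C> \<and> K \<subseteq> \<Union>\<F> \<and> \<Union>\<F> \<subseteq> U"
    if K: "closedin Y K" and U: "openin Y U" and "K \<subseteq> U" for K U
  proof -
    let ?F = "topspace Y - U"
    have "generate_topology_on \<B> (topspace Y - K)"
      by (rule openin_topology_generated_by) (use K in \<open>simp add: closedin_def flip: Y\<close>)
    then have "\<forall>y\<in>?F. \<exists>\<W>. finite \<W> \<and> \<W> \<subseteq> \<B> \<and> y \<in> \<Inter>\<W> \<and> \<Inter>\<W> \<inter> \<Union>\<B> \<subseteq> topspace Y - K"
      using \<open>K \<subseteq> U\<close> by (intro ballI generate_topology_on_nbhd) auto
    then obtain \<W> where \<W>: "\<And>y. y \<in> ?F \<Longrightarrow> finite (\<W> y)" "\<And>y. y \<in> ?F \<Longrightarrow> \<W> y \<subseteq> \<B>"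
        "\<And>y. y \<in> ?F \<Longrightarrow> y \<in> \<Inter>(\<W> y)" "\<And>y. y \<in> ?F \<Longrightarrow> \<Inter>(\<W> y) \<inter> topspace Y \<subseteq> topspace Y - K"
      unfolding top by metis
    have "compactin Y ?F"
      using U supercompact_imp_compact_space[OF assms] by (simp add: closedin_compact_space closedin_diff)
    moreover have "openin Y (\<Inter>(\<W> y) \<inter> topspace Y)" if "y \<in> ?F" for y
    proof -
      have "openin Y (topspace Y \<inter> \<Inter>(\<W> y))"
        using \<W>(1,2)[OF that] openB by (intro openin_Int_Inter) auto
      then show ?thesis
        by (simp add: Int_commute)
    qed
    moreover have "?F \<subseteq> \<Union>((\<lambda>y. \<Inter>(\<W> y) \<inter> topspace Y) ` ?F)"
      using \<W>(3) by blast
    ultimately obtain \<G> where \<G>: "finite \<G>" "\<G> \<subseteq> (\<lambda>y. \<Inter>(\<W> y) \<inter> topspace Y) ` ?F" "?F \<subseteq> \<Union>\<G>"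
      using compactinD[of Y ?F "(\<lambda>y. \<Inter>(\<W> y) \<inter> topspace Y) ` ?F"] by auto
    obtain N where N: "N \<subseteq> ?F" "finite N" "\<G> = (\<lambda>y. \<Inter>(\<W> y) \<inter> topspace Y) ` N"
      using finite_subset_image[OF \<G>(1,2)] by auto
    \<comment> \<open>Distributivity: the complement of the finite union of the sets
      \<open>\<Inter>(\<W> y)\<close> is the union, over all ways \<open>f\<close> of choosing one
      member of each \<open>\<W> y\<close>, of the complement of the chosen members. It contains
      \<open>K\<close> because the cover of \<open>?F\<close> misses \<open>K\<close>, and lies in
      \<open>U\<close> because the cover contains \<open>?F\<close>.\<close>
    define \<F> where "\<F> = (\<lambda>f. topspace Y - \<Union>(f ` N)) ` (\<Pi>\<^sub>E y\<in>N. \<W> y)"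
    have "finite (\<Pi>\<^sub>E y\<in>N. \<W> y)"
      using N \<W>(1) by (intro finite_PiE) auto
    then have "finite \<F>"
      by (simp add: \<F>_def)
    moreover have "\<F> \<subseteq> \<C>"
    proof
      fix C
      assume "C \<in> \<F>"
      then obtain f where f: "f \<in> (\<Pi>\<^sub>E y\<in>N. \<W> y)" "C = topspace Y - \<Union>(f ` N)"
        by (auto simp: \<F>_def)
      have "f y \<in> \<B>" if "y \<in> N" for y
        using PiE_mem[OF f(1) that] \<W>(2)[of y] that N(1) by blast
      then show "C \<in> \<C>"
        using N(2) unfolding f(2) \<C>_def by blast
    qed
    moreover have "K \<subseteq> \<Union>\<F>"
    proof
      fix x
      assume "x \<in> K"
      then have "x \<in> topspace Y"
        using closedin_subset[OF K] by blast
      have "\<exists>W\<in>\<W> y. x \<notin> W" if "y \<in> N" for y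
        using that \<W>(4)[of y] N(1) \<open>x \<in> K\<close> \<open>x \<in> topspace Y\<close> by blast
      then obtain g where g: "\<And>y. y \<in> N \<Longrightarrow> g y \<in> \<W> y" "\<And>y. y \<in> N \<Longrightarrow> x \<notin> g y"
        by metis
      have "restrict g N \<in> (\<Pi>\<^sub>E y\<in>N. \<W> y)" "x \<in> topspace Y - \<Union>(restrict g N ` N)"
        using g \<open>x \<in> topspace Y\<close> by auto
      then show "x \<in> \<Union>\<F>"
        unfolding \<F>_def by blast
    qed
    moreover have "\<Union>\<F> \<subseteq> U"
    proof
      fix x
      assume "x \<in> \<Union>\<F>"
      then obtain f where f: "f \<in> (\<Pi>\<^sub>E y\<in>N. \<W> y)" "x \<in> topspace Y" "\<And>y. y \<in> N \<Longrightarrow> x \<notin> f y"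
        by (auto simp: \<F>_def)
      show "x \<in> U"
      proof (rule ccontr)
        assume "x \<notin> U"
        then obtain y where "y \<in> N" "x \<in> \<Inter>(\<W> y)"
          using \<G>(3) f(2) unfolding N(3) by blast
        then show False
          using PiE_mem[OF f(1)] f(3) by blast
      qed
    qed
    ultimately show ?thesis
      by blast
  qed
  ultimately show ?thesis
    by (intro exI[of _ \<C>]) simp
qed

text \<open>A form of Bell's theorem that the remainder of a supercompact compactification of the
  integers satisfies the countable chain condition. For uncountably many \<open>a\<close> the sets \<open>S a\<close> share a
  point, so if a member \<open>T\<close> of the binary family meets infinitely many of them, then \<open>T\<close> and all these
  \<open>S b\<close> have a common point, which lies in \<open>D\<close>. This gives a finite \<open>E a\<close> in \<open>D\<close> that misses \<open>S a\<close>
  and meets \<open>S b\<close> for almost all \<open>b\<close>; two indices with the same \<open>E a\<close> are contradictory.\<close>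

lemma supercompact_almost_disjoint_countable:
  assumes super: "supercompact_space Y" and "countable D"
    and V: "\<And>a. a \<in> A \<Longrightarrow> openin Y (V a)"
    and K: "\<And>a. a \<in> A \<Longrightarrow> closedin Y (K a)" "\<And>a. a \<in> A \<Longrightarrow> K a \<subseteq> V a"
    and inf: "\<And>a. a \<in> A \<Longrightarrow> infinite (K a \<inter> D)"
    and ad: "\<And>a b. a \<in> A \<Longrightarrow> b \<in> A \<Longrightarrow> a \<noteq> b \<Longrightarrow> finite (V a \<inter> V b) \<and> V a \<inter> V b \<subseteq> D"
  shows "countable A"
proof (rule ccontr)
  assume "uncountable A"
  obtain \<C> where closed: "\<forall>C\<in>\<C>. closedin Y C"
    and binary: "\<forall>\<L>\<subseteq>\<C>. \<L> \<noteq> {} \<and> (\<forall>A\<in>\<L>. \<forall>B\<in>\<L>. A \<inter> B \<noteq> {}) \<longrightarrow> \<Inter>\<L> \<noteq> {}"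
    and between: "\<forall>K U. closedin Y K \<and> openin Y U \<and> K \<subseteq> U \<longrightarrow>
      (\<exists>\<F>. finite \<F> \<and> \<F> \<subseteq> \<C> \<and> K \<subseteq> \<Union>\<F> \<and> \<Union>\<F> \<subseteq> U)"
    using supercompact_space_closed_family[OF super] by (elim exE conjE)
  \<comment> \<open>Finitely many members of \<open>\<C>\<close> inside \<open>V a\<close> cover
    \<open>K a\<close>, so one of them has infinite trace on \<open>D\<close>. Being infinite, it
    cannot fit into a finite \<open>V a \<inter> V b\<close>.\<close>
  have "\<exists>S\<in>\<C>. S \<subseteq> V a \<and> infinite (S \<inter> D)" if "a \<in> A" for a
  proof -
    obtain \<F> where \<F>: "finite \<F>" "\<F> \<subseteq> \<C>" "K a \<subseteq> \<Union>\<F>" "\<Union>\<F> \<subseteq> V a"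
      using between[THEN spec, THEN spec, of "K a" "V a"] K V \<open>a \<in> A\<close> by auto
    have "\<exists>S\<in>\<F>. infinite (S \<inter> D)"
    proof (rule ccontr)
      assume "\<not> ?thesis"
      then have "finite (\<Union>S\<in>\<F>. S \<inter> D)"
        using \<F>(1) by blast
      moreover have "K a \<inter> D \<subseteq> (\<Union>S\<in>\<F>. S \<inter> D)"
        using \<F>(3) by blast
      ultimately show False
        using inf[OF that] finite_subset by blast
    qed
    then show ?thesis
      using \<F> by blast
  qed
  then obtain S where S: "\<And>a. a \<in> A \<Longrightarrow> S a \<in> \<C>" "\<And>a. a \<in> A \<Longrightarrow> S a \<subseteq> V a"
      "\<And>a. a \<in> A \<Longrightarrow> infinite (S a \<inter> D)"
    by metis
  have "\<exists>n. n \<in> S a \<inter> D" if "a \<in> A" for a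
    using S(3)[OF that] by (metis ex_in_conv finite.emptyI)
  then obtain n where n: "\<And>a. a \<in> A \<Longrightarrow> n a \<in> S a \<inter> D"
    by metis
  have "\<exists>n0\<in>D. uncountable {a \<in> A. n a = n0}"
    by (rule uncountable_pigeonhole[OF \<open>uncountable A\<close> \<open>countable D\<close>]) (use n in auto)
  then obtain n0 where "uncountable {a \<in> A. n a = n0}"
    by (elim bexE)
  moreover define B where "B = {a \<in> A. n a = n0}"
  ultimately have "uncountable B"
    by simp
  have BA: "a \<in> A" if "a \<in> B" for a
    using that by (simp add: B_def)
  have n0: "n0 \<in> S a" if "a \<in> B" for a
    using that n[of a] by (auto simp: B_def)
  have "\<exists>E. finite E \<and> E \<subseteq> D \<and> S a \<inter> E = {} \<and> finite {b \<in> B. S b \<inter> E = {}}" if "a \<in> B" for a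
  proof -
    \<comment> \<open>The family is now applied outside: its members in \<open>\<T>\<close> cover
      the complement of \<open>V a\<close> and miss \<open>S a\<close>. Any other \<open>S b\<close>
      is too large to stay inside \<open>V a\<close>, hence meets some member of
      \<open>\<T>\<close>.\<close>
    have "closedin Y (topspace Y - V a)" "openin Y (topspace Y - S a)"
        "topspace Y - V a \<subseteq> topspace Y - S a"
      using V[OF BA[OF that]] closed[rule_format, OF S(1)[OF BA[OF that]]] S(2)[OF BA[OF that]]
      by (auto intro: openin_diff closedin_diff)
    then have "\<exists>\<T>. finite \<T> \<and> \<T> \<subseteq> \<C> \<and> topspace Y - V a \<subseteq> \<Union>\<T> \<and> \<Union>\<T> \<subseteq> topspace Y - S a"
      by (intro between[rule_format] conjI)
    then obtain \<T> where \<T>: "finite \<T>" "\<T> \<subseteq> \<C>" "topspace Y - V a \<subseteq> \<Union>\<T>" "\<Union>\<T> \<subseteq> topspace Y - S a"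
      by (elim exE conjE)
    define hit where "hit T = {b \<in> B. S b \<inter> T \<noteq> {}}" for T
    define \<T>2 where "\<T>2 = {T \<in> \<T>. infinite (hit T)}"
    have "\<exists>m. m \<in> T \<and> m \<in> D \<and> (\<forall>b\<in>hit T. m \<in> S b)" if T: "T \<in> \<T>2" for T
    proof -
      have "T \<in> \<C>" "infinite (hit T)"
        using T \<T>(2) by (auto simp: \<T>2_def)
      let ?\<L> = "insert T (S ` hit T)"
      have S_hit: "S ` hit T \<subseteq> \<C>"
        using S(1) BA by (auto simp: hit_def)
      have "T \<noteq> {}"
        using \<open>infinite (hit T)\<close> by (auto simp: hit_def)
      have "\<Inter>?\<L> \<noteq> {}"
      proof (rule binary[THEN spec, THEN mp, THEN mp])
        show "?\<L> \<subseteq> \<C>"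
          using \<open>T \<in> \<C>\<close> S_hit by blast
        show "?\<L> \<noteq> {} \<and> (\<forall>P\<in>?\<L>. \<forall>Q\<in>?\<L>. P \<inter> Q \<noteq> {})"
        proof (intro conjI ballI)
          fix P Q
          assume "P \<in> ?\<L>" "Q \<in> ?\<L>"
          moreover have "S b \<inter> S c \<noteq> {}" if "b \<in> hit T" "c \<in> hit T" for b c
            using n0[of b] n0[of c] that by (auto simp: hit_def)
          moreover have "S b \<inter> T \<noteq> {}" "T \<inter> S b \<noteq> {}" if "b \<in> hit T" for b
            using that by (auto simp: hit_def)
          ultimately show "P \<inter> Q \<noteq> {}"
            using \<open>T \<noteq> {}\<close> by (elim insertE imageE) simp_all
        qed simp
      qed
      then obtain m where m: "m \<in> T" "\<And>b. b \<in> hit T \<Longrightarrow> m \<in> S b"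
        by blast
      obtain b where b: "b \<in> hit T"
        using \<open>infinite (hit T)\<close> by (metis ex_in_conv finite.emptyI)
      \<comment> \<open>A second index is needed because \<open>ad\<close> places a point in
        \<open>D\<close> only if it belongs to two distinct sets \<open>V b\<close> and
        \<open>V b'\<close>.\<close>
      have "infinite (hit T - {b})"
        using \<open>infinite (hit T)\<close> by simp
      then obtain b' where b': "b' \<in> hit T" "b' \<noteq> b"
        by (metis Diff_iff ex_in_conv finite.emptyI singletonI)
      have "b \<in> A" "b' \<in> A"
        using b b' BA by (auto simp: hit_def)
      then have "m \<in> V b \<inter> V b'"
        using m(2)[OF b] m(2)[OF b'(1)] S(2) by blast
      then have "m \<in> D"
        using ad[OF \<open>b \<in> A\<close> \<open>b' \<in> A\<close>] b'(2) by blast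
      then show ?thesis
        using m by blast
    qed
    then obtain m where m: "\<And>T. T \<in> \<T>2 \<Longrightarrow> m T \<in> T" "\<And>T. T \<in> \<T>2 \<Longrightarrow> m T \<in> D"
        "\<And>T b. T \<in> \<T>2 \<Longrightarrow> b \<in> hit T \<Longrightarrow> m T \<in> S b"
      by metis
    let ?E = "m ` \<T>2"
    have "finite ?E"
      using \<T>(1) by (simp add: \<T>2_def)
    moreover have "?E \<subseteq> D"
      using m(2) by blast
    moreover have "S a \<inter> ?E = {}"
      using m(1) \<T>(4) by (auto simp: \<T>2_def)
    moreover have "finite {b \<in> B. S b \<inter> ?E = {}}"
    proof (rule finite_subset)
      \<comment> \<open>An index that is not \<open>a\<close> and hits no \<open>T\<close> with
        finite \<open>hit T\<close> hits some \<open>T\<close> in \<open>\<T>2\<close>, so that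
        \<open>S b\<close> contains \<open>m T\<close>.\<close>
      show "finite (insert a (\<Union>T\<in>\<T> - \<T>2. hit T))"
        using \<T>(1) by (auto simp: \<T>2_def)
      show "{b \<in> B. S b \<inter> ?E = {}} \<subseteq> insert a (\<Union>T\<in>\<T> - \<T>2. hit T)"
      proof clarify
        fix b
        assume "b \<in> B" "S b \<inter> ?E = {}" "b \<notin> (\<Union>T\<in>\<T> - \<T>2. hit T)"
        show "b = a"
        proof (rule ccontr)
          assume "b \<noteq> a"
          then have "finite (V a \<inter> V b)"
            using ad[of a b] BA \<open>a \<in> B\<close> \<open>b \<in> B\<close> by blast
          moreover have "infinite (S b)"
            using S(3)[OF BA[OF \<open>b \<in> B\<close>]] by blast
          ultimately have "\<not> S b \<subseteq> V a \<inter> V b"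
            using finite_subset by blast
          then obtain y where "y \<in> S b" "y \<notin> V a"
            using S(2)[OF BA[OF \<open>b \<in> B\<close>]] by blast
          moreover have "S b \<subseteq> topspace Y"
            using closed[rule_format, OF S(1)[OF BA[OF \<open>b \<in> B\<close>]]] closedin_subset by blast
          ultimately obtain T where "T \<in> \<T>" "y \<in> T"
            using \<T>(3) by blast
          then have "b \<in> hit T"
            using \<open>b \<in> B\<close> \<open>y \<in> S b\<close> by (auto simp: hit_def)
          then have "T \<in> \<T>2"
            using \<open>b \<notin> (\<Union>T\<in>\<T> - \<T>2. hit T)\<close> \<open>T \<in> \<T>\<close> by blast
          then show False
            using m(3)[OF _ \<open>b \<in> hit T\<close>] \<open>S b \<inter> ?E = {}\<close> by blast
        qed
      qed
    qed
    ultimately show ?thesis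
      by blast
  qed
  then obtain E where E: "\<And>a. a \<in> B \<Longrightarrow> finite (E a) \<and> E a \<subseteq> D" "\<And>a. a \<in> B \<Longrightarrow> S a \<inter> E a = {}"
      "\<And>a. a \<in> B \<Longrightarrow> finite {b \<in> B. S b \<inter> E a = {}}"
    by metis
  have "countable (Fpow D)"
    by (rule countable_Fpow[OF \<open>countable D\<close>])
  then have "\<exists>F\<in>Fpow D. uncountable {a \<in> B. E a = F}"
    by (rule uncountable_pigeonhole[OF \<open>uncountable B\<close>]) (use E(1) in \<open>auto simp: Fpow_def\<close>)
  then obtain F where F: "uncountable {a \<in> B. E a = F}"
    by (elim bexE)
  then have "{a \<in> B. E a = F} \<noteq> {}"
    by (intro notI) simp
  then obtain a where "a \<in> B" "E a = F"
    by auto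
  have "{b \<in> B. E b = F} \<subseteq> {b \<in> B. S b \<inter> F = {}}"
    using E(2) by blast
  then have "finite {b \<in> B. E b = F}"
    using E(3)[OF \<open>a \<in> B\<close>] \<open>E a = F\<close> finite_subset by blast
  then show False
    using F countable_finite by blast
qed

section \<open>Discrete subspaces\<close>

text \<open>The discrete sets \<open>A\<close> need not be closed, so compactness alone does not
  make them finite.\<close>

definition countable_spread :: "'a topology \<Rightarrow> bool" where
  "countable_spread X \<longleftrightarrow>
     (\<forall>A\<subseteq>topspace X. (\<forall>x\<in>A. \<exists>U. openin X U \<and> U \<inter> A = {x}) \<longrightarrow> countable A)"

lemma countable_spreadD:
  assumes "countable_spread X" "A \<subseteq> topspace X"
    and "\<And>x. x \<in> A \<Longrightarrow> \<exists>U. openin X U \<and> U \<inter> A = {x}"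
  shows "countable A"
  using assms unfolding countable_spread_def by simp

lemma regular_space_nbhd:
  assumes "regular_space X" "openin X U" "x \<in> U"
  shows "\<exists>V C. openin X V \<and> closedin X C \<and> x \<in> V \<and> V \<subseteq> C \<and> C \<subseteq> U"
  using assms unfolding neighbourhood_base_of_closedin[symmetric] neighbourhood_base_of by simp

lemma closure_of_meets:
  assumes "x \<in> X closure_of S" "openin X T" "x \<in> T"
  shows "\<exists>y. y \<in> S \<and> y \<in> T"
  using assms by (simp add: in_closure_of)

text \<open>Almost disjoint forcing: a condition \<open>(F, s)\<close> is a finite part of \<open>D'\<close> with the promise that all
  further points avoid \<open>V \<alpha> \<inter> V \<beta>\<close> for distinct \<open>\<alpha>\<close>, \<open>\<beta>\<close> in \<open>s\<close>.\<close>

lemma martins_axiom_almost_disjoint_trace: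
  fixes a :: "w1 \<Rightarrow> 'a"
  assumes MA: "martins_axiom TYPE(real)" and CH: "\<not> continuum_hypothesis"
    and "countable D"
    and V: "\<And>\<alpha>. V \<alpha> \<subseteq> topspace X"
    and W: "\<And>\<alpha>. openin X (W \<alpha>)" "\<And>\<alpha>. a \<alpha> \<in> W \<alpha>"
    and sep: "\<And>\<alpha> \<gamma>. \<alpha> \<noteq> \<gamma> \<Longrightarrow> a \<gamma> \<notin> X closure_of (V \<alpha>)"
    and acc: "\<And>\<gamma> U. openin X U \<Longrightarrow> a \<gamma> \<in> U \<Longrightarrow> infinite (U \<inter> D)"
  shows "\<exists>D'\<subseteq>D. (\<forall>\<alpha>. infinite (D' \<inter> W \<alpha>)) \<and> (\<forall>\<alpha> \<beta>. \<alpha> \<noteq> \<beta> \<longrightarrow> finite (D' \<inter> (V \<alpha> \<inter> V \<beta>)))"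
proof -
  define P :: "('a set \<times> w1 set) set" where "P = Fpow D \<times> Fpow UNIV"
  define le where "le F' F s \<longleftrightarrow> F \<subseteq> F' \<and> (\<forall>\<alpha>\<in>s. \<forall>\<beta>\<in>s. \<alpha> \<noteq> \<beta> \<longrightarrow> (F' - F) \<inter> (V \<alpha> \<inter> V \<beta>) = {})"
    for F' F :: "'a set" and s :: "w1 set"
  define r where "r = {((F', s'), (F, s)). (F', s') \<in> P \<and> (F, s) \<in> P \<and> s \<subseteq> s' \<and> le F' F s}"
  \<comment> \<open>Letting \<open>n\<close> vary makes the trace on \<open>W \<gamma>\<close>
    infinite; already \<open>n = 0\<close> puts \<gamma> among the indices about which the filter
    makes promises.\<close>
  define E where "E = (\<lambda>(\<gamma>, n). {(F, s) \<in> P. \<gamma> \<in> s \<and> n \<le> card (F \<inter> W \<gamma>)})"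
  have le_refl: "le F F s" for F s
    by (simp add: le_def)
  have le_trans: "le F'' F s" if "le F'' F' s'" "le F' F s" "s \<subseteq> s'" for F F' F'' s s'
    unfolding le_def
  proof (intro conjI ballI impI)
    show "F \<subseteq> F''"
      using that by (auto simp: le_def)
    fix \<alpha> \<beta>
    assume "\<alpha> \<in> s" "\<beta> \<in> s" "\<alpha> \<noteq> \<beta>"
    moreover from this have "\<alpha> \<in> s'" "\<beta> \<in> s'"
      using that(3) by auto
    ultimately have "(F'' - F') \<inter> (V \<alpha> \<inter> V \<beta>) = {}" "(F' - F) \<inter> (V \<alpha> \<inter> V \<beta>) = {}"
      using that(1,2) by (simp_all add: le_def)
    then show "(F'' - F) \<inter> (V \<alpha> \<inter> V \<beta>) = {}"
      by auto
  qed
  have "P \<noteq> {}"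
    by (auto simp: P_def Fpow_def)
  moreover have "partial_order_on P r"
    unfolding partial_order_on_def preorder_on_def
  proof (intro conjI)
    show "r \<subseteq> P \<times> P" "refl_on P r"
      by (auto simp: r_def refl_on_def le_refl)
    show "antisym r"
      by (auto simp: r_def antisym_def le_def)
    show "trans r"
    proof (rule transI)
      fix x y z
      assume xy: "(x, y) \<in> r" and yz: "(y, z) \<in> r"
      then show "(x, z) \<in> r"
        unfolding r_def by (auto intro: le_trans)
    qed
  qed
  moreover have "countable_chain_condition P r"
    unfolding countable_chain_condition_def
  proof (intro allI impI)
    fix A
    assume "A \<subseteq> P" and anti: "\<forall>p\<in>A. \<forall>q\<in>A. p \<noteq> q \<longrightarrow> \<not> forcing_compatible P r p q"
    \<comment> \<open>Conditions with the same first component have the common extension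
      \<open>(F, s \<union> s')\<close>: no point is added, so no promise can be broken. An
      antichain is therefore no larger than the countable \<open>Fpow D\<close>.\<close>
    have "inj_on fst A"
    proof (rule inj_onI)
      fix p q
      assume pq: "p \<in> A" "q \<in> A" "fst p = fst q"
      then obtain F s s' where "p = (F, s)" "q = (F, s')"
        by (metis prod.collapse)
      moreover have "(F, s) \<in> P" "(F, s') \<in> P"
        using pq \<open>A \<subseteq> P\<close> calculation by auto
      ultimately have "forcing_compatible P r p q"
        unfolding forcing_compatible_def
        by (intro bexI[of _ "(F, s \<union> s')"]) (auto simp: r_def P_def Fpow_def le_refl)
      then show "p = q"
        using anti pq by blast
    qed
    moreover have "fst ` A \<subseteq> Fpow D"
      using \<open>A \<subseteq> P\<close> by (auto simp: P_def)
    then have "countable (fst ` A)"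
      using countable_Fpow[OF \<open>countable D\<close>] countable_subset by blast
    ultimately show "countable A"
      using countable_image_inj_on by blast
  qed
  moreover have "P \<lesssim> (UNIV :: real set)"
    unfolding P_def
    using assms(3) lesspoll_imp_lepoll[OF w1_lesspoll_reals[OF CH]]
    by (intro times_lepoll_reals Fpow_lepoll_reals)
      (metis Pow_countable_lepoll_reals lepoll_Pow_self lepoll_trans)
  moreover have "forcing_dense P r (E i)" for i
  proof -
    obtain \<gamma> n where i: "i = (\<gamma>, n)"
      by (cases i)
    have "\<exists>d\<in>E i. (d, p) \<in> r" if "p \<in> P" for p
    proof -
      obtain F s where p: "p = (F, s)"
        by (cases p)
      then have F: "finite F" "F \<subseteq> D" "finite s"
        using that by (auto simp: P_def Fpow_def)
      \<comment> \<open>A point of \<open>N\<close> avoids \<open>V \<alpha>\<close> for every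
        \<alpha> in \<open>s\<close> other than \<gamma>. Of two distinct indices in
        \<open>s\<close> one differs from \<gamma>, so points of \<open>N\<close> can be added
        without breaking a promise.\<close>
      define N where "N = W \<gamma> - (\<Union>\<alpha>\<in>s - {\<gamma>}. X closure_of (V \<alpha>))"
      have "openin X N"
        unfolding N_def using F(3) W(1) by (intro openin_diff closedin_Union) auto
      moreover have "a \<gamma> \<in> N"
        using sep W(2) by (auto simp: N_def)
      ultimately obtain T where T: "T \<subseteq> N \<inter> D" "finite T" "card T = n"
        using acc infinite_arbitrarily_large by meson
      have "T \<inter> (V \<alpha> \<inter> V \<beta>) = {}" if "\<alpha> \<in> s" "\<beta> \<in> s" "\<alpha> \<noteq> \<beta>" for \<alpha> \<beta>
      proof -
        have "T \<inter> V \<delta> = {}" if "\<delta> \<in> s" "\<delta> \<noteq> \<gamma>" for \<delta>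
          using T(1) that closure_of_subset[OF V[of \<delta>]] by (auto simp: N_def)
        then show ?thesis
          using that by (cases "\<alpha> = \<gamma>") auto
      qed
      then have "le (F \<union> T) F s"
        by (auto simp: le_def)
      moreover have "n \<le> card ((F \<union> T) \<inter> W \<gamma>)"
      proof -
        have "T \<subseteq> (F \<union> T) \<inter> W \<gamma>"
          using T(1) by (auto simp: N_def)
        then show ?thesis
          using T(2,3) F(1) by (metis card_mono finite_Int finite_UnI)
      qed
      ultimately show ?thesis
        using F T by (intro bexI[of _ "(F \<union> T, insert \<gamma> s)"])
          (auto simp: p i E_def r_def P_def Fpow_def)
    qed
    then show ?thesis
      unfolding forcing_dense_def by (auto simp: E_def i)
  qed
  ultimately obtain G where G: "forcing_filter P r G" and GE: "\<And>i. i \<in> UNIV \<Longrightarrow> G \<inter> E i \<noteq> {}"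
    using martins_axiom_generic[OF MA, of P r UNIV E] w1_times_nat_lesspoll_reals[OF CH] by metis
  have GP: "p \<in> P" if "p \<in> G" for p
    using G that by (auto simp: forcing_filter_def)
  have G_dir: "\<exists>t\<in>G. (t, p) \<in> r \<and> (t, q) \<in> r" if "p \<in> G" "q \<in> G" for p q
    using G that by (simp add: forcing_filter_def)
  define D' where "D' = \<Union>(fst ` G)"
  show ?thesis
  proof (intro exI[of _ D'] conjI allI impI)
    show "D' \<subseteq> D"
      using GP by (fastforce simp: D'_def P_def Fpow_def)
    show "infinite (D' \<inter> W \<alpha>)" for \<alpha>
    proof
      assume fin: "finite (D' \<inter> W \<alpha>)"
      obtain F s where Fs: "(F, s) \<in> G" "Suc (card (D' \<inter> W \<alpha>)) \<le> card (F \<inter> W \<alpha>)"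
        using GE[of "(\<alpha>, Suc (card (D' \<inter> W \<alpha>)))"] by (auto simp: E_def)
      then have "F \<inter> W \<alpha> \<subseteq> D' \<inter> W \<alpha>"
        by (force simp: D'_def)
      from card_mono[OF fin this] show False
        using Fs(2) by simp
    qed
    fix \<alpha> \<beta> :: w1
    assume "\<alpha> \<noteq> \<beta>"
    obtain p where p: "p \<in> G" "\<alpha> \<in> snd p"
      using GE[of "(\<alpha>, 0)"] by (auto simp: E_def)
    obtain q where q: "q \<in> G" "\<beta> \<in> snd q"
      using GE[of "(\<beta>, 0)"] by (auto simp: E_def)
    obtain t where t: "t \<in> G" "(t, p) \<in> r" "(t, q) \<in> r"
      using G_dir[OF p(1) q(1)] by blast
    obtain F s where Fs: "t = (F, s)"
      by (cases t)
    have ab: "\<alpha> \<in> s" "\<beta> \<in> s" "finite F"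
      using t p(2) q(2) GP[OF t(1)] by (auto simp: r_def Fs P_def Fpow_def)
    \<comment> \<open>The condition \<open>t\<close> promises about both \<alpha> and \<beta>. A
      point contributed by any \<open>u\<close> in the filter appears in a common extension of
      \<open>u\<close> and \<open>t\<close>, so it was in \<open>F\<close> already or avoids the
      intersection.\<close>
    have "D' \<inter> (V \<alpha> \<inter> V \<beta>) \<subseteq> F"
    proof
      fix x
      assume x: "x \<in> D' \<inter> (V \<alpha> \<inter> V \<beta>)"
      then obtain u where u: "u \<in> G" "x \<in> fst u"
        by (auto simp: D'_def)
      obtain v where v: "(v, t) \<in> r" "(v, u) \<in> r"
        using G_dir[OF t(1) u(1)] by blast
      have "x \<in> fst v"
        using v(2) u(2) by (auto simp: r_def le_def)
      have "le (fst v) F s"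
        using v(1) by (auto simp: r_def Fs)
      then have "(fst v - F) \<inter> (V \<alpha> \<inter> V \<beta>) = {}"
        using ab \<open>\<alpha> \<noteq> \<beta>\<close> by (simp add: le_def)
      then show "x \<in> F"
        using x \<open>x \<in> fst v\<close> by auto
    qed
    then show "finite (D' \<inter> (V \<alpha> \<inter> V \<beta>))"
      using ab(3) finite_subset by blast
  qed
qed

theorem hereditarily_supercompact_countable_spread:
  assumes MA: "martins_axiom TYPE(real)" and CH: "\<not> continuum_hypothesis"
    and sepX: "separable_space X" and super: "hereditarily_supercompact_space X"
    and reg: "regular_space X" and haus: "Hausdorff_space X"
  shows "countable_spread X"
  unfolding countable_spread_def
proof (intro allI impI)
  fix A
  assume A: "A \<subseteq> topspace X" and disc: "\<forall>x\<in>A. \<exists>U. openin X U \<and> U \<inter> A = {x}"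
  show "countable A"
  proof (rule ccontr)
    assume "uncountable A"
    obtain D where D: "countable D" "D \<subseteq> topspace X" "X closure_of D = topspace X"
      using sepX unfolding separable_space_def by blast
    \<comment> \<open>With \<open>a \<gamma>\<close> outside \<open>D\<close>, a finite part of
      \<open>D\<close> can be deleted from a neighbourhood without losing \<open>a \<gamma>\<close>;
      density then makes every neighbourhood contain infinitely many points of
      \<open>D\<close>.\<close>
    have "uncountable (A - D)"
      using \<open>uncountable A\<close> D(1) by (simp add: uncountable_minus_countable)
    then obtain a :: "w1 \<Rightarrow> 'a" where a: "inj a" "range a \<subseteq> A - D"
      using w1_lepoll_uncountable unfolding lepoll_def by metis
    have aA: "a \<alpha> \<in> A" "a \<alpha> \<notin> D" for \<alpha>
      using a(2) by auto
    have "\<exists>U. openin X U \<and> U \<inter> A = {a \<alpha>}" for \<alpha>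
      using disc aA by simp
    then obtain U where U: "\<And>\<alpha>. openin X (U \<alpha>)" "\<And>\<alpha>. U \<alpha> \<inter> A = {a \<alpha>}"
      by metis
    have "a \<alpha> \<in> U \<alpha>" for \<alpha>
      using U(2)[of \<alpha>] by blast
    \<comment> \<open>Two shrinkings are needed: \<open>B\<close> keeps the closure of
      \<open>V \<alpha>\<close> away from the other points of the sequence, and \<open>C\<close>
      will be the closed set with infinite trace inside the open \<open>V \<alpha>\<close>.\<close>
    then have "\<forall>\<alpha>. \<exists>V B. openin X V \<and> closedin X B \<and> a \<alpha> \<in> V \<and> V \<subseteq> B \<and> B \<subseteq> U \<alpha>"
      using regular_space_nbhd[OF reg U(1)] by simp
    then obtain V B where V: "\<And>\<alpha>. openin X (V \<alpha>)" "\<And>\<alpha>. closedin X (B \<alpha>)" "\<And>\<alpha>. a \<alpha> \<in> V \<alpha>"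
        "\<And>\<alpha>. V \<alpha> \<subseteq> B \<alpha>" "\<And>\<alpha>. B \<alpha> \<subseteq> U \<alpha>"
      by metis
    have "\<forall>\<alpha>. \<exists>W C. openin X W \<and> closedin X C \<and> a \<alpha> \<in> W \<and> W \<subseteq> C \<and> C \<subseteq> V \<alpha>"
      using regular_space_nbhd[OF reg V(1)] V(3) by simp
    then obtain W C where W: "\<And>\<alpha>. openin X (W \<alpha>)" "\<And>\<alpha>. closedin X (C \<alpha>)" "\<And>\<alpha>. a \<alpha> \<in> W \<alpha>"
        "\<And>\<alpha>. W \<alpha> \<subseteq> C \<alpha>" "\<And>\<alpha>. C \<alpha> \<subseteq> V \<alpha>"
      by metis
    have fin_closed: "closedin X F" if "finite F" "F \<subseteq> topspace X" for F
      using haus that by (simp add: closedin_Hausdorff_finite)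
    have "\<exists>D'\<subseteq>D. (\<forall>\<alpha>. infinite (D' \<inter> W \<alpha>)) \<and> (\<forall>\<alpha> \<beta>. \<alpha> \<noteq> \<beta> \<longrightarrow> finite (D' \<inter> (V \<alpha> \<inter> V \<beta>)))"
    proof (rule martins_axiom_almost_disjoint_trace[OF MA CH D(1), where X = X and a = a])
      show "V \<alpha> \<subseteq> topspace X" for \<alpha>
        using V(1) openin_subset by blast
      show "a \<gamma> \<notin> X closure_of V \<alpha>" if "\<alpha> \<noteq> \<gamma>" for \<alpha> \<gamma>
      proof
        assume "a \<gamma> \<in> X closure_of V \<alpha>"
        then have "a \<gamma> \<in> U \<alpha>"
          using closure_of_minimal[OF V(4,2)] V(5) by blast
        then have "a \<gamma> = a \<alpha>"
          using U(2)[of \<alpha>] aA(1)[of \<gamma>] by blast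
        then show False
          using a(1) that by (simp add: inj_eq)
      qed
      show "infinite (N \<inter> D)" if "openin X N" "a \<gamma> \<in> N" for \<gamma> N
      proof
        assume "finite (N \<inter> D)"
        then have "openin X (N - (N \<inter> D))"
          using D(2) that(1) by (intro openin_diff fin_closed) auto
        moreover have "a \<gamma> \<in> N - (N \<inter> D)"
          using that(2) aA by blast
        moreover have "a \<gamma> \<in> X closure_of D"
          using D(3) A aA by blast
        ultimately have "\<exists>y. y \<in> D \<and> y \<in> N - (N \<inter> D)"
          by (intro closure_of_meets[where X = X])
        then show False
          by auto
      qed
    qed (use W in auto)
    then obtain D' where D': "D' \<subseteq> D" "\<And>\<alpha>. infinite (D' \<inter> W \<alpha>)"
        "\<And>\<alpha> \<beta>. \<alpha> \<noteq> \<beta> \<Longrightarrow> finite (D' \<inter> (V \<alpha> \<inter> V \<beta>))"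
      by auto
    have "D' \<subseteq> topspace X" "countable D'"
      using D' D countable_subset by auto
    let ?F = "X closure_of D'"
    let ?Y = "subtopology X ?F"
    have "D' \<subseteq> ?F"
      using \<open>D' \<subseteq> topspace X\<close> by (rule closure_of_subset)
    have "countable (UNIV :: w1 set)"
    proof (rule supercompact_almost_disjoint_countable)
      show "supercompact_space ?Y"
        using super by (simp add: hereditarily_supercompact_space_def)
      show "countable D'" by fact
      fix \<alpha> :: w1
      show "openin ?Y (V \<alpha> \<inter> ?F)"
        using V(1) by (simp add: openin_subtopology_Int)
      show "closedin ?Y (C \<alpha> \<inter> ?F)"
        using W(2) by (auto simp: closedin_subtopology)
      show "C \<alpha> \<inter> ?F \<subseteq> V \<alpha> \<inter> ?F"
        using W(5) by blast
      have "D' \<inter> W \<alpha> \<subseteq> C \<alpha> \<inter> ?F \<inter> D'"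
        using W(4) \<open>D' \<subseteq> ?F\<close> by blast
      then show "infinite (C \<alpha> \<inter> ?F \<inter> D')"
        using D'(2) finite_subset by blast
      fix \<beta> :: w1
      assume "\<alpha> \<noteq> \<beta>"
      have "closedin X (D' \<inter> (V \<alpha> \<inter> V \<beta>))"
        using D'(3)[OF \<open>\<alpha> \<noteq> \<beta>\<close>] \<open>D' \<subseteq> topspace X\<close> by (intro fin_closed) auto
      \<comment> \<open>Inside an open set, the closure of \<open>D'\<close> comes from the part of
        \<open>D'\<close> in that set. This part is finite, hence closed, so passing to the closure
        adds no point to the overlap.\<close>
      moreover have "V \<alpha> \<inter> V \<beta> \<inter> ?F \<subseteq> X closure_of (V \<alpha> \<inter> V \<beta> \<inter> D')"
        using V(1) by (intro openin_Int_closure_of_subset openin_Int)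
      ultimately have "V \<alpha> \<inter> V \<beta> \<inter> ?F \<subseteq> D' \<inter> (V \<alpha> \<inter> V \<beta>)"
        by (simp add: closure_of_closedin Int_commute)
      then have "V \<alpha> \<inter> ?F \<inter> (V \<beta> \<inter> ?F) \<subseteq> D' \<inter> (V \<alpha> \<inter> V \<beta>)"
        by blast
      then show "finite (V \<alpha> \<inter> ?F \<inter> (V \<beta> \<inter> ?F)) \<and> V \<alpha> \<inter> ?F \<inter> (V \<beta> \<inter> ?F) \<subseteq> D'"
        using D'(3)[OF \<open>\<alpha> \<noteq> \<beta>\<close>] finite_subset by blast
    qed
    then show False
      using uncountable_UNIV_w1 by simp
  qed
qed

section \<open>Countable tightness\<close>

text \<open>Tightness as a property of sets closed under closures of countable subsets, the form
  that images under closed maps preserve; \<open>countably_tight_closure_of\<close> recovers the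
  pointwise form.\<close>

definition countably_tight :: "'a topology \<Rightarrow> bool" where
  "countably_tight X \<longleftrightarrow>
     (\<forall>A\<subseteq>topspace X. (\<forall>C\<subseteq>A. countable C \<longrightarrow> X closure_of C \<subseteq> A) \<longrightarrow> closedin X A)"

lemma countably_tightD:
  assumes "countably_tight X" "A \<subseteq> topspace X"
    and "\<And>C. C \<subseteq> A \<Longrightarrow> countable C \<Longrightarrow> X closure_of C \<subseteq> A"
  shows "closedin X A"
  using assms unfolding countably_tight_def by simp

text \<open>The union of the closures of all countable subsets of \<open>A\<close> is itself closed
  under countable closures, since countably many countable sets combine into one.\<close>

lemma countably_tight_closure_of:
  assumes tight: "countably_tight X" and "A \<subseteq> topspace X" and x: "x \<in> X closure_of A"
  shows "\<exists>C\<subseteq>A. countable C \<and> x \<in> X closure_of C"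
proof -
  define B where "B = (\<Union>C\<in>{C. C \<subseteq> A \<and> countable C}. X closure_of C)"
  have "closedin X B"
  proof (rule countably_tightD[OF tight])
    show "B \<subseteq> topspace X"
      unfolding B_def using closure_of_subset_topspace by fast
    fix C
    assume "C \<subseteq> B" "countable C"
    have "\<forall>c\<in>C. \<exists>K. K \<subseteq> A \<and> countable K \<and> c \<in> X closure_of K"
      using \<open>C \<subseteq> B\<close> unfolding B_def by auto
    then obtain K where K: "\<And>c. c \<in> C \<Longrightarrow> K c \<subseteq> A" "\<And>c. c \<in> C \<Longrightarrow> countable (K c)"
        "\<And>c. c \<in> C \<Longrightarrow> c \<in> X closure_of K c"
      by metis
    let ?L = "\<Union>c\<in>C. K c"
    have L: "?L \<subseteq> A" "countable ?L"
      using K \<open>countable C\<close> by auto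
    have "C \<subseteq> X closure_of ?L"
    proof
      fix c
      assume "c \<in> C"
      then have "X closure_of K c \<subseteq> X closure_of ?L"
        by (intro closure_of_mono) auto
      then show "c \<in> X closure_of ?L"
        using K(3)[OF \<open>c \<in> C\<close>] by auto
    qed
    then have "X closure_of C \<subseteq> X closure_of ?L"
      by (simp add: closure_of_minimal)
    also have "\<dots> \<subseteq> B"
      using L unfolding B_def by auto
    finally show "X closure_of C \<subseteq> B" .
  qed
  moreover have "A \<subseteq> B"
  proof
    fix a
    assume "a \<in> A"
    then have "a \<in> X closure_of {a}"
      using assms(2) closure_of_subset[of "{a}" X] by auto
    then show "a \<in> B"
      using \<open>a \<in> A\<close> unfolding B_def by (intro UN_I[of "{a}"]) auto
  qed
  ultimately have "X closure_of A \<subseteq> B"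
    by (simp add: closure_of_minimal)
  then show ?thesis
    using x unfolding B_def by auto
qed

text \<open>Choose points of \<open>A\<close> in more and more of the neighbourhoods. By compactness
  the sequence has a cluster point; it lies in every closed \<open>V\<close>, and in
  \<open>A\<close> by \<open>omega\<close>. This feeds the limit stages of the free
  sequence.\<close>

lemma omega_closed_meets_countable_nbhds:
  assumes X: "compact_space X" and "A \<subseteq> topspace X"
    and omega: "\<And>C. C \<subseteq> A \<Longrightarrow> countable C \<Longrightarrow> X closure_of C \<subseteq> A"
    and y: "y \<in> X closure_of A"
    and "countable \<V>" and closed: "\<And>V. V \<in> \<V> \<Longrightarrow> closedin X V"
    and nbhd: "\<And>V. V \<in> \<V> \<Longrightarrow> y \<in> X interior_of V"
  shows "A \<inter> \<Inter>\<V> \<noteq> {}"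
proof (cases "\<V> = {}")
  case True
  have "A \<noteq> {}"
    using y by (intro notI) simp
  then show ?thesis
    using True by simp
next
  case False
  then obtain g :: "nat \<Rightarrow> 'a set" where g: "\<V> = range g"
    using \<open>countable \<V>\<close> by (metis range_from_nat_into)
  have "\<exists>x. x \<in> A \<and> x \<in> (\<Inter>i\<in>{..k}. X interior_of (g i))" for k
    by (rule closure_of_meets[OF y]) (use nbhd g in auto)
  then have "\<forall>k. \<exists>x. x \<in> A \<and> x \<in> (\<Inter>i\<in>{..k}. X interior_of (g i))"
    by simp
  then obtain x where "\<forall>k. x k \<in> A \<and> x k \<in> (\<Inter>i\<in>{..k}. X interior_of (g i))"
    by (auto dest: choice)
  then have x: "\<And>k. x k \<in> A" "\<And>k i. i \<le> k \<Longrightarrow> x k \<in> X interior_of (g i)"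
    by auto
  define T where "T k = X closure_of (x ` {k..})" for k
  have xX: "range x \<subseteq> topspace X"
    using x(1) assms(2) by auto
  have "(\<Inter>k. T k) \<noteq> {}"
  proof (rule compact_space_imp_nest[OF X])
    show "closedin X (T k)" for k
      by (simp add: T_def)
    show "T k \<noteq> {}" for k
      using xX by (subst T_def, subst closure_of_eq_empty) auto
    show "decseq T"
      unfolding decseq_def T_def by (intro allI impI closure_of_mono) auto
  qed
  then obtain z where z: "\<And>k. z \<in> T k"
    by auto
  have "X closure_of (x ` {0..}) \<subseteq> A"
    using x(1) by (intro omega) auto
  then have "z \<in> A"
    using z[of 0] unfolding T_def by blast
  moreover have "z \<in> g k" for k
  proof -
    have "x ` {k..} \<subseteq> g k"
      using x(2)[of k] interior_of_subset[of X "g k"] by auto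
    moreover have "closedin X (g k)"
      using closed g by simp
    ultimately have "T k \<subseteq> g k"
      unfolding T_def by (rule closure_of_minimal)
    then show ?thesis
      using z by blast
  qed
  ultimately show ?thesis
    using g by auto
qed

text \<open>If tightness fails at \<open>y\<close>, a free sequence of length \<open>w1\<close> is built from neighbourhoods of
  \<open>y\<close>; free sequences are discrete.\<close>

lemma countable_spread_imp_countably_tight:
  assumes X: "compact_space X" and reg: "regular_space X" and spread: "countable_spread X"
  shows "countably_tight X"
  unfolding countably_tight_def
proof (intro allI impI)
  fix A
  assume A: "A \<subseteq> topspace X" and "\<forall>C\<subseteq>A. countable C \<longrightarrow> X closure_of C \<subseteq> A"
  then have omega: "X closure_of C \<subseteq> A" if "C \<subseteq> A" "countable C" for C
    using that by simp
  show "closedin X A"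
  proof (rule ccontr)
    assume "\<not> closedin X A"
    then have "\<not> X closure_of A \<subseteq> A"
      using A closure_of_subset_eq by blast
    then obtain y where y: "y \<in> X closure_of A" "y \<notin> A"
      by auto
    \<comment> \<open>A stage pairs a point of \<open>A\<close> with a closed neighbourhood of
      \<open>y\<close>. Points enter all neighbourhoods chosen so far, while each neighbourhood
      avoids the closure of the earlier points.\<close>
    define P :: "(w1 \<Rightarrow> 'a \<times> 'a set) \<Rightarrow> w1 \<Rightarrow> 'a \<times> 'a set \<Rightarrow> bool" where
      "P f \<alpha> p \<longleftrightarrow> fst p \<in> A \<and> fst p \<in> snd p \<and> (\<forall>\<beta><\<alpha>. fst p \<in> snd (f \<beta>)) \<and>
         closedin X (snd p) \<and> y \<in> X interior_of (snd p) \<and>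
         snd p \<inter> X closure_of ((\<lambda>\<beta>. fst (f \<beta>)) ` {..<\<alpha>}) = {}" for f \<alpha> p
    have "\<exists>f. \<forall>\<alpha>. P f \<alpha> (f \<alpha>)"
    proof (rule dependent_wf_choice)
      show "wf {(\<beta>, \<alpha> :: w1). \<beta> < \<alpha>}"
        by (rule wf)
      show "P f \<alpha> p = P g \<alpha> p" if "\<And>\<beta>. (\<beta>, \<alpha>) \<in> {(\<beta>, \<alpha>). \<beta> < \<alpha>} \<Longrightarrow> f \<beta> = g \<beta>" for f g \<alpha> p
      proof -
        have "(\<lambda>\<beta>. fst (f \<beta>)) ` {..<\<alpha>} = (\<lambda>\<beta>. fst (g \<beta>)) ` {..<\<alpha>}"
          using that by (intro image_cong) auto
        then show ?thesis
          using that by (simp add: P_def)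
      qed
      fix \<alpha> f
      assume IH: "\<And>\<beta>. (\<beta>, \<alpha>) \<in> {(\<beta>, \<alpha>). \<beta> < \<alpha>} \<Longrightarrow> P f \<beta> (f \<beta>)"
      let ?C = "(\<lambda>\<beta>. fst (f \<beta>)) ` {..<\<alpha>}"
      have "X closure_of ?C \<subseteq> A"
        using IH countable_lessThan_w1 by (intro omega) (auto simp: P_def)
      then have "y \<in> topspace X - X closure_of ?C"
        using y by (auto simp: in_closure_of)
      then obtain V B where V: "openin X V" "closedin X B" "y \<in> V" "V \<subseteq> B" "B \<subseteq> topspace X - X closure_of ?C"
        using regular_space_nbhd[OF reg openin_diff[OF openin_topspace closedin_closure_of]] by metis
      have "A \<inter> \<Inter>(insert B ((\<lambda>\<beta>. snd (f \<beta>)) ` {..<\<alpha>})) \<noteq> {}"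
      proof (rule omega_closed_meets_countable_nbhds[OF X A omega y(1)])
        show "countable (insert B ((\<lambda>\<beta>. snd (f \<beta>)) ` {..<\<alpha>}))"
          using countable_lessThan_w1 by auto
        show "closedin X W" if "W \<in> insert B ((\<lambda>\<beta>. snd (f \<beta>)) ` {..<\<alpha>})" for W
          using that IH V(2) by (auto simp: P_def)
        have "y \<in> X interior_of B"
          using interior_of_maximal[OF V(4,1)] V(3) by blast
        then show "y \<in> X interior_of W" if "W \<in> insert B ((\<lambda>\<beta>. snd (f \<beta>)) ` {..<\<alpha>})" for W
          using that IH by (auto simp: P_def)
      qed
      then obtain x where x: "x \<in> A" "x \<in> B" "\<And>\<beta>. \<beta> < \<alpha> \<Longrightarrow> x \<in> snd (f \<beta>)"
        by auto
      have "y \<in> X interior_of B"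
        using interior_of_maximal[OF V(4,1)] V(3) by blast
      then have "P f \<alpha> (x, B)"
        using x V(2,5) by (auto simp: P_def)
      then show "\<exists>p. P f \<alpha> p" ..
    qed
    then obtain f where f: "\<And>\<alpha>. P f \<alpha> (f \<alpha>)"
      by auto
    define x where "x \<alpha> = fst (f \<alpha>)" for \<alpha>
    define V where "V \<alpha> = snd (f \<alpha>)" for \<alpha>
    have xV: "x \<alpha> \<in> V \<beta>" if "\<beta> \<le> \<alpha>" for \<alpha> \<beta>
      using f[of \<alpha>] that by (cases "\<beta> = \<alpha>") (auto simp: P_def x_def V_def)
    have closedV: "closedin X (V \<alpha>)" for \<alpha>
      using f[of \<alpha>] by (simp add: P_def V_def)
    have disj: "V \<alpha> \<inter> X closure_of (x ` {..<\<alpha>}) = {}" for \<alpha>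
      using f[of \<alpha>] unfolding P_def x_def V_def by blast
    have xA: "range x \<subseteq> topspace X"
      using f A by (auto simp: P_def x_def)
    have notV: "x \<beta> \<notin> V \<alpha>" if "\<beta> < \<alpha>" for \<alpha> \<beta>
    proof -
      have "x ` {..<\<alpha>} \<subseteq> X closure_of (x ` {..<\<alpha>})"
        using xA by (intro closure_of_subset) auto
      then show ?thesis
        using disj[of \<alpha>] that by blast
    qed
    have "inj x"
      using xV notV by (metis injI less_le_not_le linorder_less_linear order_refl)
    have "countable (range x)"
    proof (rule countable_spreadD[OF spread xA])
      fix p
      assume "p \<in> range x"
      then obtain \<alpha> where p: "p = x \<alpha>"
        by auto
      \<comment> \<open>With \<sigma> the successor of \<alpha>, removing \<open>V \<sigma>\<close>
        discards all later points and removing the closure of the initial segment discards all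
        earlier ones; \<open>x \<alpha>\<close> alone remains.\<close>
      obtain \<sigma> where \<sigma>: "\<alpha> < \<sigma>" "\<And>\<beta>. \<alpha> < \<beta> \<Longrightarrow> \<sigma> \<le> \<beta>"
      proof
        obtain \<gamma> where "\<alpha> < \<gamma>"
          using countable_bounded_w1[of "{\<alpha>}"] by auto
        then show "\<alpha> < (LEAST \<gamma>. \<alpha> < \<gamma>)"
          by (rule LeastI)
        show "(LEAST \<gamma>. \<alpha> < \<gamma>) \<le> \<beta>" if "\<alpha> < \<beta>" for \<beta>
          using that by (rule Least_le)
      qed
      define U where "U = (topspace X - X closure_of (x ` {..<\<alpha>})) \<inter> (topspace X - V \<sigma>)"
      have "openin X U"
        unfolding U_def using closedV by (intro openin_Int openin_diff) auto
      moreover have "x \<alpha> \<in> U"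
        unfolding U_def using xA disj[of \<alpha>] xV[of \<alpha> \<alpha>] notV[OF \<sigma>(1)] by auto
      moreover have "x \<beta> \<notin> U" if "\<beta> \<noteq> \<alpha>" for \<beta>
      proof (cases "\<beta> < \<alpha>")
        case True
        have "x ` {..<\<alpha>} \<subseteq> X closure_of (x ` {..<\<alpha>})"
          using xA by (intro closure_of_subset) auto
        then show ?thesis
          using True unfolding U_def by blast
      next
        case False
        then have "\<sigma> \<le> \<beta>"
          using that \<sigma>(2) by auto
        then show ?thesis
          using xV unfolding U_def by blast
      qed
      ultimately have "openin X U \<and> U \<inter> range x = {p}"
        unfolding p by (fast elim!: rangeE)
      then show "\<exists>U. openin X U \<and> U \<inter> range x = {p}" ..
    qed
    then show False
      using \<open>inj x\<close> uncountable_UNIV_w1 countable_image_inj_on by blast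
  qed
qed

text \<open>Think of \<open>Z\<close> as a compact subset of a product with coordinates
  \<open>f\<close> and \<open>g\<close>. Let \<open>z\<close> be in the closure of \<open>A\<close>
  but not in \<open>A\<close>. On the fibre of \<open>f\<close> through \<open>z\<close>, the values
  of \<open>g\<close> on \<open>A\<close> form a closed set missing \<open>g z\<close>, so a closed
  neighbourhood \<open>B\<close> of \<open>g z\<close> avoids it. The part of \<open>A\<close> where
  \<open>g\<close> lies in \<open>B\<close> has a closed image under \<open>f\<close>, which
  contains \<open>f z\<close>: a point of \<open>A\<close> in the fibre with \<open>g\<close> in
  \<open>B\<close>.\<close>

lemma countably_tight_jointly_injective:
  assumes Z: "compact_space Z" and X: "Hausdorff_space X" "regular_space X" and Y: "Hausdorff_space Y"
    and f: "continuous_map Z Y f" and g: "continuous_map Z X g"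
    and inj: "\<And>a b. a \<in> topspace Z \<Longrightarrow> b \<in> topspace Z \<Longrightarrow> f a = f b \<Longrightarrow> g a = g b \<Longrightarrow> a = b"
    and tX: "countably_tight X" and tY: "countably_tight Y"
  shows "countably_tight Z"
  unfolding countably_tight_def
proof (intro allI impI)
  fix A
  assume A: "A \<subseteq> topspace Z" and "\<forall>C\<subseteq>A. countable C \<longrightarrow> Z closure_of C \<subseteq> A"
  then have omega: "Z closure_of C \<subseteq> A" if "C \<subseteq> A" "countable C" for C
    using that by simp
  \<comment> \<open>A countable subset of the image lifts to a countable subset of \<open>A\<close>,
    whose closure stays in \<open>A\<close> and has closed image; tightness of \<open>W\<close> does
    the rest.\<close>
  have image: "closedin W (h ` (A \<inter> K))"
    if W: "Hausdorff_space W" "countably_tight W" and h: "continuous_map Z W h" and K: "closedin Z K"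
    for W :: "'x topology" and h K
  proof (rule countably_tightD[OF W(2)])
    show "h ` (A \<inter> K) \<subseteq> topspace W"
      using A h by (auto simp: continuous_map_def)
    fix C
    assume C: "C \<subseteq> h ` (A \<inter> K)" "countable C"
    obtain C0 where C0: "C0 \<subseteq> A \<inter> K" "countable C0" "C = h ` C0"
      using countable_subset_image[of C h "A \<inter> K"] C by auto
    have "C0 \<subseteq> Z closure_of C0"
      using C0(1) A by (intro closure_of_subset) auto
    then have "C \<subseteq> h ` (Z closure_of C0)"
      using C0(3) by auto
    moreover have "closedin W (h ` (Z closure_of C0))"
      using continuous_imp_closed_map[OF h Z W(1)] by (simp add: closed_map_def)
    ultimately have "W closure_of C \<subseteq> h ` (Z closure_of C0)"
      by (rule closure_of_minimal)
    moreover have "Z closure_of C0 \<subseteq> A"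
      using C0 by (intro omega) auto
    moreover have "Z closure_of C0 \<subseteq> K"
      using C0 K by (intro closure_of_minimal) auto
    ultimately show "W closure_of C \<subseteq> h ` (A \<inter> K)"
      by blast
  qed
  show "closedin Z A"
  proof (rule ccontr)
    assume "\<not> closedin Z A"
    then have "\<not> Z closure_of A \<subseteq> A"
      using A closure_of_subset_eq by blast
    then obtain z where z: "z \<in> Z closure_of A" "z \<notin> A"
      by auto
    have zZ: "z \<in> topspace Z"
      using z(1) by (simp add: in_closure_of)
    have fg: "f z \<in> topspace Y" "g z \<in> topspace X"
      using zZ f g by (auto simp: continuous_map_def)
    let ?K = "{a \<in> topspace Z. f a \<in> {f z}}"
    have "closedin Y {f z}"
      using closedin_Hausdorff_finite[OF Y, of "{f z}"] fg by simp
    then have "closedin Z ?K"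
      by (rule closedin_continuous_map_preimage[OF f])
    then have "closedin X (g ` (A \<inter> ?K))"
      by (rule image[OF X(1) tX g])
    moreover have "g z \<notin> g ` (A \<inter> ?K)"
      using inj[OF zZ] z(2) by fastforce
    ultimately have "openin X (topspace X - g ` (A \<inter> ?K))" "g z \<in> topspace X - g ` (A \<inter> ?K)"
      using fg by (auto intro: openin_diff)
    then have "\<exists>V B. openin X V \<and> closedin X B \<and> g z \<in> V \<and> V \<subseteq> B \<and>
        B \<subseteq> topspace X - g ` (A \<inter> ?K)"
      by (rule regular_space_nbhd[OF X(2)])
    then obtain V B where V: "openin X V" "closedin X B" "g z \<in> V" "V \<subseteq> B"
        "B \<subseteq> topspace X - g ` (A \<inter> ?K)"
      by (elim exE conjE)
    let ?L = "{a \<in> topspace Z. g a \<in> B}"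
    have "closedin Z ?L"
      by (rule closedin_continuous_map_preimage[OF g V(2)])
    then have clo: "closedin Y (f ` (A \<inter> ?L))"
      by (rule image[OF Y tY f])
    have "f z \<in> Y closure_of (f ` (A \<inter> ?L))"
      unfolding in_closure_of
    proof (intro conjI allI impI fg(1))
      fix T
      assume T: "f z \<in> T \<and> openin Y T"
      have "\<exists>a. a \<in> A \<and> a \<in> {a \<in> topspace Z. f a \<in> T} \<inter> {a \<in> topspace Z. g a \<in> V}"
      proof (rule closure_of_meets[OF z(1)])
        show "openin Z ({a \<in> topspace Z. f a \<in> T} \<inter> {a \<in> topspace Z. g a \<in> V})"
          using T V(1) f g by (intro openin_Int openin_continuous_map_preimage) auto
        show "z \<in> {a \<in> topspace Z. f a \<in> T} \<inter> {a \<in> topspace Z. g a \<in> V}"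
          using zZ T V(3) by simp
      qed
      then show "\<exists>b. b \<in> f ` (A \<inter> ?L) \<and> b \<in> T"
        using V(4) by auto
    qed
    then have "f z \<in> f ` (A \<inter> ?L)"
      using clo by (simp add: closure_of_closedin)
    then obtain a where a: "a \<in> A" "g a \<in> B" "f a = f z"
      by auto
    then have "g a \<in> g ` (A \<inter> ?K)"
      using A by auto
    then show False
      using a(2) V(5) by auto
  qed
qed

text \<open>Induction splits off one coordinate: restriction to \<open>I\<close> and the coordinate
  \<open>i\<close> together determine a point. The empty power is a single point.\<close>

lemma countably_tight_power:
  fixes X :: "'a topology" and I :: "'i set"
  assumes X: "compact_space X" "Hausdorff_space X" "countably_tight X" and "finite I"
  shows "countably_tight (product_topology (\<lambda>_. X) I)"
  using \<open>finite I\<close>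
proof (induction I)
  case empty
  have "closedin (product_topology (\<lambda>_ :: 'i. X) {}) A" if "A \<subseteq> {\<lambda>_. undefined}" for A
  proof -
    have "A = {} \<or> A = topspace (product_topology (\<lambda>_ :: 'i. X) {})"
      using that by auto
    then show ?thesis
      by (elim disjE) (simp_all only: closedin_empty closedin_topspace)
  qed
  then show ?case
    by (simp add: countably_tight_def)
next
  case (insert i I)
  let ?Z = "product_topology (\<lambda>_. X) (insert i I)"
  show ?case
  proof (rule countably_tight_jointly_injective)
    show "compact_space ?Z"
      using X by (simp add: compact_space_product_topology)
    show "regular_space X"
      using X by (simp add: compact_Hausdorff_imp_regular_space)
    show "Hausdorff_space (product_topology (\<lambda>_. X) I)"
      using X by (simp add: Hausdorff_space_product_topology)
    show "continuous_map ?Z (product_topology (\<lambda>_. X) I) (\<lambda>z. restrict z I)"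
      unfolding continuous_map_componentwise
      by (auto intro: continuous_map_product_projection)
    show "continuous_map ?Z X (\<lambda>z. z i)"
      by (rule continuous_map_product_projection) simp
    show "a = b" if "a \<in> topspace ?Z" "b \<in> topspace ?Z" "restrict a I = restrict b I" "a i = b i" for a b
    proof (rule PiE_ext)
      show "a \<in> (\<Pi>\<^sub>E j\<in>insert i I. topspace X)" "b \<in> (\<Pi>\<^sub>E j\<in>insert i I. topspace X)"
        using that by simp_all
      show "a j = b j" if "j \<in> insert i I" for j
        using that \<open>a i = b i\<close> \<open>restrict a I = restrict b I\<close> by (metis insertE restrict_apply')
    qed
  qed (use X insert.IH in auto)
qed

section \<open>Hereditary Lindelofness\<close>

text \<open>Every \<open>U \<alpha>\<close> misses all later points, so initial segments of the
  sequence are relatively open. The layers have different tasks: the open \<open>V\<close> defines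
  incompatibility, the closed \<open>B\<close> survives passage to a limit, and the open
  \<open>U\<close> transfers the limit back to later points.\<close>

locale right_separated =
  fixes X :: "'a topology" and a :: "w1 \<Rightarrow> 'a" and V B U :: "w1 \<Rightarrow> 'a set"
  assumes compact: "compact_space X" and haus: "Hausdorff_space X" and tight: "countably_tight X"
    and V: "\<And>\<alpha>. openin X (V \<alpha>)" "\<And>\<alpha>. a \<alpha> \<in> V \<alpha>"
    and B: "\<And>\<alpha>. closedin X (B \<alpha>)" "\<And>\<alpha>. V \<alpha> \<subseteq> B \<alpha>"
    and U: "\<And>\<alpha>. openin X (U \<alpha>)" "\<And>\<alpha>. B \<alpha> \<subseteq> U \<alpha>"
    and right: "\<And>\<alpha> \<beta>. \<alpha> < \<beta> \<Longrightarrow> a \<beta> \<notin> U \<alpha>"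
begin

text \<open>On a free set of indices each \<open>V \<beta>\<close> isolates
  \<open>a \<beta>\<close>. As the condition concerns pairs only, a directed union of free sets is
  free.\<close>

definition free :: "w1 set \<Rightarrow> bool" where
  "free p \<longleftrightarrow> (\<forall>\<alpha>\<in>p. \<forall>\<beta>\<in>p. \<alpha> \<noteq> \<beta> \<longrightarrow> a \<alpha> \<notin> V \<beta>)"

lemma a_topspace: "a \<alpha> \<in> topspace X"
  using V openin_subset by blast

lemma free_subset: "free q \<Longrightarrow> p \<subseteq> q \<Longrightarrow> free p"
  by (auto simp: free_def)

text \<open>A bad pair cannot lie within \<open>p\<close> or within \<open>q\<close>, so it
  straddles the two differences.\<close>

lemma not_free_Un:
  assumes "free p" "free q" "\<not> free (p \<union> q)"
  obtains \<alpha> \<beta> where "\<alpha> \<in> p - q" "\<beta> \<in> q - p" "a \<alpha> \<in> V \<beta> \<or> a \<beta> \<in> V \<alpha>"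
proof -
  obtain \<alpha> \<beta> where ab: "\<alpha> \<in> p \<union> q" "\<beta> \<in> p \<union> q" "\<alpha> \<noteq> \<beta>" "a \<alpha> \<in> V \<beta>"
    using assms(3) by (auto simp: free_def)
  then have "\<not> (\<alpha> \<in> p \<and> \<beta> \<in> p)" "\<not> (\<alpha> \<in> q \<and> \<beta> \<in> q)"
    using assms(1,2) by (auto simp: free_def)
  then show thesis
    using that ab by blast
qed

text \<open>List the elements of each \<open>p\<close> as a point \<open>x p\<close> of a power of \<open>X\<close>. A point \<open>y\<close> in the closure of every
  tail lies, by countable tightness, in the closure of countably many \<open>x p\<close>, which all lie below some
  \<open>q\<close>; incompatibility with \<open>q\<close> puts a coordinate of \<open>y\<close> into some \<open>B \<beta>\<close>, contradicting that the tail
  beyond \<open>\<beta>\<close> avoids \<open>U \<beta>\<close>.\<close>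

lemma no_separated_antichain:
  assumes \<A>: "\<And>p. p \<in> \<A> \<Longrightarrow> card p = Suc n" "\<And>p. p \<in> \<A> \<Longrightarrow> free p"
    and anti: "\<And>p q. p \<in> \<A> \<Longrightarrow> q \<in> \<A> \<Longrightarrow> p \<noteq> q \<Longrightarrow> \<not> free (p \<union> q)"
    and unbounded: "\<And>\<delta>. \<exists>p\<in>\<A>. p \<subseteq> {\<delta><..}"
  shows False
proof -
  let ?I = "{..<Suc n}"
  let ?Z = "product_topology (\<lambda>_. X) ?I"
  have fin: "finite p" if "p \<in> \<A>" for p
    using \<A>(1)[OF that] by (simp add: card_ge_0_finite)
  have "\<forall>p\<in>\<A>. \<exists>e. bij_betw e ?I p"
    using fin \<A>(1) ex_bij_betw_nat_finite by (metis atLeast0LessThan)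
  then obtain e where e: "\<And>p. p \<in> \<A> \<Longrightarrow> bij_betw (e p) ?I p"
    unfolding bchoice_iff by auto
  have e_mem: "e p i \<in> p" if "p \<in> \<A>" "i \<in> ?I" for p i
    using bij_betwE[OF e[OF that(1)]] that(2) by blast
  define x where "x p = restrict (\<lambda>i. a (e p i)) ?I" for p
  have xZ: "x p \<in> topspace ?Z" for p
    using a_topspace by (auto simp: x_def)
  have x_i: "x p i = a (e p i)" if "i \<in> ?I" for p i
    using that by (simp add: x_def)
  have xZ_img: "x ` \<B> \<subseteq> topspace ?Z" for \<B>
    using xZ by blast
  define T where "T \<delta> = ?Z closure_of (x ` {p \<in> \<A>. p \<subseteq> {\<delta><..}})" for \<delta>
  have T_mono: "T \<delta>' \<subseteq> T \<delta>" if "\<delta> \<le> \<delta>'" for \<delta> \<delta>'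
  proof -
    have "{p \<in> \<A>. p \<subseteq> {\<delta>'<..}} \<subseteq> {p \<in> \<A>. p \<subseteq> {\<delta><..}}"
      using that by (auto simp: subset_eq intro: le_less_trans)
    then show ?thesis
      unfolding T_def by (intro closure_of_mono image_mono)
  qed
  have T_ne: "T \<delta> \<noteq> {}" for \<delta>
    unfolding T_def by (subst closure_of_eq_empty[OF xZ_img]) (use unbounded[of \<delta>] in auto)
  have "compact_space ?Z"
    using compact by (simp add: compact_space_product_topology)
  moreover have "\<forall>C\<in>range T. closedin ?Z C"
    by (auto simp: T_def)
  moreover have "\<forall>\<F>. finite \<F> \<and> \<F> \<subseteq> range T \<longrightarrow> \<Inter>\<F> \<noteq> {}"
  proof (intro allI impI)
    fix \<F>
    assume "finite \<F> \<and> \<F> \<subseteq> range T"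
    then obtain N where N: "finite N" "\<F> = T ` N"
      by (meson finite_subset_image)
    show "\<Inter>\<F> \<noteq> {}"
    proof (cases "N = {}")
      case False
      then have "T (Max N) \<subseteq> \<Inter>\<F>"
        unfolding N(2) using N(1) by (intro INT_greatest T_mono) simp
      then show ?thesis
        using T_ne[of "Max N"] by auto
    qed (simp add: N)
  qed
  ultimately have "\<Inter>(range T) \<noteq> {}"
    unfolding compact_space_fip by simp
  then obtain y where y: "\<And>\<delta>. y \<in> T \<delta>"
    by auto
  have "countably_tight ?Z"
    using compact haus tight by (simp add: countably_tight_power)
  moreover have "y \<in> ?Z closure_of (x ` \<A>)"
  proof -
    have "T undefined \<subseteq> ?Z closure_of (x ` \<A>)"
      unfolding T_def by (intro closure_of_mono image_mono) auto
    then show ?thesis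
      using y by (rule subsetD)
  qed
  ultimately have "\<exists>C\<subseteq>x ` \<A>. countable C \<and> y \<in> ?Z closure_of C"
    by (intro countably_tight_closure_of xZ_img)
  then obtain C where C: "C \<subseteq> x ` \<A>" "countable C" "y \<in> ?Z closure_of C"
    by auto
  obtain \<C> where \<C>: "\<C> \<subseteq> \<A>" "countable \<C>" "C = x ` \<C>"
    using countable_subset_image[of C x \<A>] C by auto
  have "countable (\<Union>p\<in>\<C>. p)"
    using \<C> fin by (intro countable_UN) (auto intro: countable_finite)
  then obtain \<delta> where \<delta>: "\<And>\<gamma>. \<gamma> \<in> (\<Union>p\<in>\<C>. p) \<Longrightarrow> \<gamma> < \<delta>"
    using countable_bounded_w1 by metis
  obtain q where q: "q \<in> \<A>" "q \<subseteq> {\<delta><..}"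
    using unbounded by blast
  have "finite q" "q \<noteq> {}"
    using fin[OF q(1)] \<A>(1)[OF q(1)] by auto
  define L where "L = (\<Union>i\<in>?I. \<Union>\<beta>\<in>q. {z \<in> topspace ?Z. z i \<in> B \<beta>})"
  have "x p \<in> L" if p: "p \<in> \<C>" for p
  proof -
    have "p \<in> \<A>"
      using p \<C>(1) by blast
    have lt: "\<alpha> < \<beta>" if "\<alpha> \<in> p" "\<beta> \<in> q" for \<alpha> \<beta>
    proof -
      have "\<alpha> < \<delta>"
        using \<delta> p that(1) by blast
      moreover have "\<delta> < \<beta>"
        using q(2) that(2) by auto
      ultimately show ?thesis
        by simp
    qed
    have "p \<noteq> q"
      using lt \<open>q \<noteq> {}\<close> by blast
    then have "\<not> free (p \<union> q)"
      by (rule anti[OF \<open>p \<in> \<A>\<close> q(1)])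
    then obtain \<alpha> \<beta> where ab: "\<alpha> \<in> p - q" "\<beta> \<in> q - p" "a \<alpha> \<in> V \<beta> \<or> a \<beta> \<in> V \<alpha>"
      by (rule not_free_Un[OF \<A>(2)[OF \<open>p \<in> \<A>\<close>] \<A>(2)[OF q(1)]])
    \<comment> \<open>All of \<open>p\<close> lies below all of \<open>q\<close>, so
      \<open>right\<close> settles which way the pair is bad.\<close>
    have "a \<beta> \<notin> V \<alpha>"
      using right[OF lt[of \<alpha> \<beta>]] ab B(2)[of \<alpha>] U(2)[of \<alpha>] by blast
    then have "a \<alpha> \<in> B \<beta>"
      using ab(3) B(2) by blast
    moreover obtain i where "i \<in> ?I" "\<alpha> = e p i"
      using e[OF \<open>p \<in> \<A>\<close>] ab(1) unfolding bij_betw_def by blast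
    ultimately show ?thesis
      using ab(2) xZ x_i unfolding L_def by auto
  qed
  then have "C \<subseteq> L"
    using \<C>(3) by blast
  moreover have "closedin ?Z {z \<in> topspace ?Z. z i \<in> B \<beta>}" if "i \<in> ?I" for i \<beta>
    by (rule closedin_continuous_map_preimage[OF continuous_map_product_projection[OF that] B(1)])
  then have "closedin ?Z L"
    unfolding L_def using \<open>finite q\<close> by (auto intro!: closedin_Union simp del: topspace_product_topology)
  ultimately have "?Z closure_of C \<subseteq> L"
    by (rule closure_of_minimal)
  then obtain i \<beta> where i: "i \<in> ?I" "\<beta> \<in> q" "y i \<in> B \<beta>" "y \<in> topspace ?Z"
    using C(3) unfolding L_def by blast
  have "\<exists>z. z \<in> x ` {p \<in> \<A>. p \<subseteq> {\<beta><..}} \<and> z \<in> {z \<in> topspace ?Z. z i \<in> U \<beta>}"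
  proof (rule closure_of_meets)
    show "y \<in> ?Z closure_of (x ` {p \<in> \<A>. p \<subseteq> {\<beta><..}})"
      using y[of \<beta>] by (simp add: T_def)
    show "openin ?Z {z \<in> topspace ?Z. z i \<in> U \<beta>}"
      by (rule openin_continuous_map_preimage[OF continuous_map_product_projection[OF i(1)] U(1)])
    show "y \<in> {z \<in> topspace ?Z. z i \<in> U \<beta>}"
      using i U(2) by blast
  qed
  then obtain p where p: "p \<in> \<A>" "p \<subseteq> {\<beta><..}" "x p i \<in> U \<beta>"
    by auto
  then have "\<beta> < e p i" "a (e p i) \<in> U \<beta>"
    using e_mem[OF p(1) i(1)] x_i[OF i(1)] by auto
  then show False
    using right by blast
qed

text \<open>The induction replaces a \<Delta>-system argument. The members containing a fixed
  \<alpha> are countably many, since deleting \<alpha> leaves an antichain of smaller sets. An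
  uncountable antichain thus has members beyond every \<delta>, which
  \<open>no_separated_antichain\<close> refutes.\<close>

lemma antichain_card_countable:
  assumes "\<And>p. p \<in> \<A> \<Longrightarrow> finite p \<and> card p = n" "\<And>p. p \<in> \<A> \<Longrightarrow> free p"
    and "\<And>p q. p \<in> \<A> \<Longrightarrow> q \<in> \<A> \<Longrightarrow> p \<noteq> q \<Longrightarrow> \<not> free (p \<union> q)"
  shows "countable \<A>"
  using assms
proof (induction n arbitrary: \<A>)
  case 0
  then have "p = {}" if "p \<in> \<A>" for p
    using that by (meson card_0_eq)
  then have "\<A> \<subseteq> {{}}"
    by auto
  then show ?case
    by (rule countable_subset) simp
next
  case (Suc n)
  have common: "countable {p \<in> \<A>. \<alpha> \<in> p}" for \<alpha>
  proof -
    let ?\<A> = "{p \<in> \<A>. \<alpha> \<in> p}"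
    have inj: "inj_on (\<lambda>p. p - {\<alpha>}) ?\<A>"
      by (rule inj_onI) (auto simp: set_eq_iff)
    have "countable ((\<lambda>p. p - {\<alpha>}) ` ?\<A>)"
    proof (rule Suc.IH)
      show "finite p \<and> card p = n" if "p \<in> (\<lambda>p. p - {\<alpha>}) ` ?\<A>" for p
        using that Suc.prems(1) by (auto simp: card_Diff_singleton)
      show "free p" if "p \<in> (\<lambda>p. p - {\<alpha>}) ` ?\<A>" for p
        using that Suc.prems(2) by (auto intro: free_subset)
      fix p q
      assume pq: "p \<in> (\<lambda>p. p - {\<alpha>}) ` ?\<A>" "q \<in> (\<lambda>p. p - {\<alpha>}) ` ?\<A>" "p \<noteq> q"
      then obtain p' q' where p'q': "p' \<in> \<A>" "\<alpha> \<in> p'" "p = p' - {\<alpha>}"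
          "q' \<in> \<A>" "\<alpha> \<in> q'" "q = q' - {\<alpha>}" "p' \<noteq> q'"
        by auto
      \<comment> \<open>The bad pair avoids the common elements, so it survives the removal of
        \<alpha>.\<close>
      obtain \<beta> \<gamma> where bc: "\<beta> \<in> p' - q'" "\<gamma> \<in> q' - p'" "a \<beta> \<in> V \<gamma> \<or> a \<gamma> \<in> V \<beta>"
        by (rule not_free_Un[OF Suc.prems(2)[OF p'q'(1)] Suc.prems(2)[OF p'q'(4)]
            Suc.prems(3)[OF p'q'(1,4,7)]])
      then have "\<beta> \<in> p \<union> q" "\<gamma> \<in> p \<union> q" "\<beta> \<noteq> \<gamma>"
        using p'q' by auto
      then have "a \<beta> \<notin> V \<gamma> \<and> a \<gamma> \<notin> V \<beta>" if "free (p \<union> q)"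
        using that unfolding free_def by metis
      then show "\<not> free (p \<union> q)"
        using bc(3) by blast
    qed
    then show ?thesis
      using inj countable_image_inj_on by blast
  qed
  show ?case
  proof (rule ccontr)
    assume unc: "uncountable \<A>"
    show False
    proof (rule no_separated_antichain)
      show "card p = Suc n" if "p \<in> \<A>" for p
        using Suc.prems(1)[OF that] by simp
      show "\<exists>p\<in>\<A>. p \<subseteq> {\<delta><..}" for \<delta>
      proof -
        have "countable (insert \<delta> {..<\<delta>})"
          using countable_lessThan_w1 by simp
        then have "countable (\<Union>\<alpha>\<in>insert \<delta> {..<\<delta>}. {p \<in> \<A>. \<alpha> \<in> p})"
          using common by blast
        then have "\<not> \<A> \<subseteq> (\<Union>\<alpha>\<in>insert \<delta> {..<\<delta>}. {p \<in> \<A>. \<alpha> \<in> p})"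
          using unc countable_subset by blast
        then obtain p where p: "p \<in> \<A>" "p \<notin> (\<Union>\<alpha>\<in>insert \<delta> {..<\<delta>}. {p \<in> \<A>. \<alpha> \<in> p})"
          by blast
        have "\<delta> < \<alpha>" if "\<alpha> \<in> p" for \<alpha>
          using p that by (metis (mono_tags, lifting) UN_I insertCI lessThan_iff linorder_neqE mem_Collect_eq)
        then show ?thesis
          using p(1) by auto
      qed
    qed (use Suc.prems in auto)
  qed
qed

lemma antichain_countable:
  assumes "\<And>p. p \<in> \<A> \<Longrightarrow> finite p" "\<And>p. p \<in> \<A> \<Longrightarrow> free p"
    and "\<And>p q. p \<in> \<A> \<Longrightarrow> q \<in> \<A> \<Longrightarrow> p \<noteq> q \<Longrightarrow> \<not> free (p \<union> q)"
  shows "countable \<A>"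
proof -
  have "countable {p \<in> \<A>. card p = n}" for n
    by (rule antichain_card_countable[where n = n]) (use assms in auto)
  then have "countable (\<Union>n. {p \<in> \<A>. card p = n})"
    by blast
  moreover have "\<A> = (\<Union>n. {p \<in> \<A>. card p = n})"
    by auto
  ultimately show ?thesis
    by simp
qed

text \<open>The condition \<open>{b}\<close> forces the generic set to be unbounded. If there were no such \<open>b\<close>, a maximal
  antichain of counterexamples could not be countable.\<close>

lemma unbounded_condition:
  "\<exists>b. \<forall>p. finite p \<and> free p \<and> b \<in> p \<longrightarrow> uncountable {\<alpha>. free (insert \<alpha> p)}"
proof (rule ccontr)
  assume "\<not> ?thesis"
  then have "\<forall>b. \<exists>p. finite p \<and> free p \<and> b \<in> p \<and> countable {\<alpha>. free (insert \<alpha> p)}"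
    by simp
  then obtain q where q: "\<And>b. finite (q b)" "\<And>b. free (q b)" "\<And>b. b \<in> q b"
      "\<And>b. countable {\<alpha>. free (insert \<alpha> (q b))}"
    by metis
  define antichains where "antichains = {\<A>. \<A> \<subseteq> range q \<and>
    (\<forall>p\<in>\<A>. \<forall>p'\<in>\<A>. p \<noteq> p' \<longrightarrow> \<not> free (p \<union> p'))}"
  have "\<exists>\<M>\<in>antichains. \<forall>\<A>\<in>antichains. \<M> \<subseteq> \<A> \<longrightarrow> \<A> = \<M>"
  proof (rule subset_Zorn')
    fix \<K>
    assume \<K>: "subset.chain antichains \<K>"
    show "\<Union>\<K> \<in> antichains"
      unfolding antichains_def
    proof (intro CollectI conjI ballI impI)
      show "\<Union>\<K> \<subseteq> range q"
        using \<K> by (auto simp: subset_chain_def antichains_def)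
      fix p p'
      assume "p \<in> \<Union>\<K>" "p' \<in> \<Union>\<K>" "p \<noteq> p'"
      then obtain K K' where K: "K \<in> \<K>" "p \<in> K" "K' \<in> \<K>" "p' \<in> K'"
        by blast
      then have "K \<subseteq> K' \<or> K' \<subseteq> K"
        using \<K> by (auto simp: subset_chain_def)
      then obtain M where "M \<in> \<K>" "p \<in> M" "p' \<in> M"
        using K by blast
      moreover have "M \<in> antichains"
        using \<K> \<open>M \<in> \<K>\<close> by (auto simp: subset_chain_def)
      ultimately show "\<not> free (p \<union> p')"
        using \<open>p \<noteq> p'\<close> by (simp add: antichains_def)
    qed
  qed
  then obtain \<M> where \<M>: "\<M> \<in> antichains" "\<And>\<A>. \<A> \<in> antichains \<Longrightarrow> \<M> \<subseteq> \<A> \<Longrightarrow> \<A> = \<M>"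
    by auto
  have \<M>q: "\<exists>b. p = q b" if "p \<in> \<M>" for p
    using that \<M>(1) by (auto simp: antichains_def)
  have \<M>anti: "\<not> free (p \<union> p')" if "p \<in> \<M>" "p' \<in> \<M>" "p \<noteq> p'" for p p'
    using that \<M>(1) by (simp add: antichains_def)
  have \<M>q': "finite p \<and> free p \<and> countable {\<alpha>. free (insert \<alpha> p)}" if "p \<in> \<M>" for p
    using \<M>q[OF that] q by metis
  have "countable \<M>"
    by (rule antichain_countable) (simp_all add: \<M>q' \<M>anti)
  then have "countable (\<Union>p\<in>\<M>. {\<alpha>. free (insert \<alpha> p)})"
    using \<M>q' by (intro countable_UN) auto
  then obtain b where b: "b \<notin> (\<Union>p\<in>\<M>. {\<alpha>. free (insert \<alpha> p)})"
    using uncountable_UNIV_w1 by (metis UNIV_eq_I)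
  \<comment> \<open>Compatibility would make \<open>b\<close> one of the extensions of
    \<open>p\<close>, all of which \<open>b\<close> was chosen to avoid. Maximality then puts
    \<open>q b\<close> into \<open>\<M>\<close>, where \<open>b\<close> is trivially an
    extension.\<close>
  have "\<not> free (q b \<union> p)" if "p \<in> \<M>" for p
  proof
    assume "free (q b \<union> p)"
    then have "free (insert b p)"
      by (rule free_subset) (use q(3)[of b] in auto)
    then show False
      using b that by auto
  qed
  then have "insert (q b) \<M> \<in> antichains"
    using \<M>(1) by (auto simp: antichains_def Un_commute)
  then have "q b \<in> \<M>"
    using \<M>(2)[of "insert (q b) \<M>"] by auto
  moreover have "free (insert b (q b))"
    using q(2,3) by (simp add: insert_absorb)
  ultimately show False
    using b by auto
qed

text \<open>Conditions are required to contain the \<open>b\<close> of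
  \<open>unbounded_condition\<close>, which makes each \<open>E \<gamma>\<close> dense. The union of
  the generic filter is free and unbounded in \<open>w1\<close>, so it indexes an uncountable
  discrete subspace.\<close>

lemma not_countable_spread:
  assumes MA: "martins_axiom TYPE(real)" and CH: "\<not> continuum_hypothesis"
  shows "\<not> countable_spread X"
proof
  assume spread: "countable_spread X"
  obtain b where b: "\<forall>p. finite p \<and> free p \<and> b \<in> p \<longrightarrow> uncountable {\<alpha>. free (insert \<alpha> p)}"
    using unbounded_condition by (rule exE)
  define P where "P = {p. finite p \<and> free p \<and> b \<in> p}"
  define r where "r = {(q, p). q \<in> P \<and> p \<in> P \<and> p \<subseteq> q}"
  define E where "E \<gamma> = {p \<in> P. \<exists>\<alpha>\<in>p. \<gamma> < \<alpha>}" for \<gamma>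
  have "{b} \<in> P"
    by (simp add: P_def free_def)
  then have "P \<noteq> {}"
    by blast
  moreover have "partial_order_on P r"
    by (auto simp: partial_order_on_def preorder_on_def refl_on_def trans_def antisym_def r_def)
  moreover have "countable_chain_condition P r"
    unfolding countable_chain_condition_def
  proof (intro allI impI)
    fix \<A>
    assume "\<A> \<subseteq> P" and anti: "\<forall>p\<in>\<A>. \<forall>q\<in>\<A>. p \<noteq> q \<longrightarrow> \<not> forcing_compatible P r p q"
    show "countable \<A>"
    proof (rule antichain_countable)
      show "finite p" "free p" if "p \<in> \<A>" for p
        using that \<open>\<A> \<subseteq> P\<close> by (auto simp: P_def)
      fix p q
      assume pq: "p \<in> \<A>" "q \<in> \<A>" "p \<noteq> q"
      then have "p \<in> P" "q \<in> P"
        using \<open>\<A> \<subseteq> P\<close> by auto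
      show "\<not> free (p \<union> q)"
      proof
        assume "free (p \<union> q)"
        then have "p \<union> q \<in> P"
          using \<open>p \<in> P\<close> \<open>q \<in> P\<close> by (simp add: P_def)
        then have "forcing_compatible P r p q"
          unfolding forcing_compatible_def using \<open>p \<in> P\<close> \<open>q \<in> P\<close>
          by (intro bexI[of _ "p \<union> q"]) (auto simp: r_def)
        then show False
          using anti pq by simp
      qed
    qed
  qed
  moreover have "P \<lesssim> (UNIV :: real set)"
  proof -
    have "P \<lesssim> Fpow (UNIV :: w1 set)"
      by (rule subset_imp_lepoll) (auto simp: P_def Fpow_def)
    also have "\<dots> \<lesssim> (UNIV :: real set)"
      by (rule Fpow_lepoll_reals[OF lesspoll_imp_lepoll[OF w1_lesspoll_reals[OF CH]]])
    finally show ?thesis .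
  qed
  moreover have "forcing_dense P r (E \<gamma>)" for \<gamma>
  proof -
    have "\<exists>d\<in>E \<gamma>. (d, p) \<in> r" if "p \<in> P" for p
    proof -
      have "uncountable {\<alpha>. free (insert \<alpha> p)}"
        using b that by (simp add: P_def)
      then obtain \<alpha> where "free (insert \<alpha> p)" "\<gamma> < \<alpha>"
        by (rule uncountable_unbounded_w1) auto
      then show ?thesis
        using that by (intro bexI[of _ "insert \<alpha> p"]) (auto simp: E_def r_def P_def)
    qed
    then show ?thesis
      by (auto simp: forcing_dense_def E_def)
  qed
  ultimately obtain G where G: "forcing_filter P r G" and GE: "\<And>\<gamma>. \<gamma> \<in> UNIV \<Longrightarrow> G \<inter> E \<gamma> \<noteq> {}"
    using martins_axiom_generic[OF MA, of P r UNIV E] w1_lesspoll_reals[OF CH] by metis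
  have free_G: "free (\<Union>G)"
    unfolding free_def
  proof (intro ballI impI)
    fix \<alpha> \<beta>
    assume "\<alpha> \<in> \<Union>G" "\<beta> \<in> \<Union>G" "\<alpha> \<noteq> \<beta>"
    then obtain p q where "p \<in> G" "\<alpha> \<in> p" "q \<in> G" "\<beta> \<in> q"
      by blast
    then have "\<exists>s\<in>G. (s, p) \<in> r \<and> (s, q) \<in> r"
      using G by (simp add: forcing_filter_def)
    then obtain s where "(s, p) \<in> r" "(s, q) \<in> r"
      by blast
    then have "free s" "\<alpha> \<in> s" "\<beta> \<in> s"
      using \<open>\<alpha> \<in> p\<close> \<open>\<beta> \<in> q\<close> by (auto simp: r_def P_def)
    then show "a \<alpha> \<notin> V \<beta>"
      using \<open>\<alpha> \<noteq> \<beta>\<close> by (simp add: free_def)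
  qed
  have "uncountable (\<Union>G)"
  proof
    assume "countable (\<Union>G)"
    then obtain \<gamma> where \<gamma>: "\<And>\<alpha>. \<alpha> \<in> \<Union>G \<Longrightarrow> \<alpha> < \<gamma>"
      using countable_bounded_w1 by metis
    obtain p \<alpha> where "p \<in> G" "\<alpha> \<in> p" "\<gamma> < \<alpha>"
      using GE[of \<gamma>] by (auto simp: E_def)
    moreover from this have "\<alpha> < \<gamma>"
      by (intro \<gamma>) blast
    ultimately show False
      by simp
  qed
  have "inj a"
  proof (rule linorder_injI)
    fix \<alpha> \<beta> :: w1
    assume "\<alpha> < \<beta>"
    then have "a \<beta> \<notin> U \<alpha>"
      by (rule right)
    moreover have "a \<alpha> \<in> U \<alpha>"
      using V(2) B(2) U(2) by (meson subsetD)
    ultimately show "a \<alpha> \<noteq> a \<beta>"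
      by metis
  qed
  have "countable (a ` \<Union>G)"
  proof (rule countable_spreadD[OF spread])
    show "a ` \<Union>G \<subseteq> topspace X"
      using a_topspace by blast
    fix x
    assume "x \<in> a ` \<Union>G"
    then obtain \<alpha> where \<alpha>: "\<alpha> \<in> \<Union>G" "x = a \<alpha>"
      by blast
    have "V \<alpha> \<inter> a ` \<Union>G = {x}"
    proof
      show "{x} \<subseteq> V \<alpha> \<inter> a ` \<Union>G"
        using \<alpha> V(2) by blast
      show "V \<alpha> \<inter> a ` \<Union>G \<subseteq> {x}"
      proof
        fix z
        assume "z \<in> V \<alpha> \<inter> a ` \<Union>G"
        then obtain \<beta> where "\<beta> \<in> \<Union>G" "z = a \<beta>" "a \<beta> \<in> V \<alpha>"
          by auto
        then have "\<beta> = \<alpha>"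
          using free_G \<alpha>(1) unfolding free_def by metis
        then show "z \<in> {x}"
          using \<open>z = a \<beta>\<close> \<alpha>(2) by simp
      qed
    qed
    then show "\<exists>U. openin X U \<and> U \<inter> a ` \<Union>G = {x}"
      by (intro exI[of _ "V \<alpha>"] conjI V(1))
  qed
  then have "countable (\<Union>G)"
    by (rule countable_image_inj_on) (use \<open>inj a\<close> in \<open>auto intro: inj_on_subset\<close>)
  then show False
    using \<open>uncountable (\<Union>G)\<close> by simp
qed

end

text \<open>From a cover without countable subcover, recursion picks a point outside all earlier
  chosen members together with a member containing it. The result is a right-separated sequence,
  refuted by \<open>not_countable_spread\<close>.\<close>

theorem countable_spread_hereditarily_Lindelof:
  assumes MA: "martins_axiom TYPE(real)" and CH: "\<not> continuum_hypothesis"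
    and compact: "compact_space X" and haus: "Hausdorff_space X" and spread: "countable_spread X"
  shows "hereditarily Lindelof_space X"
  unfolding hereditarily_def
proof (intro allI impI)
  fix S
  assume S: "S \<subseteq> topspace X"
  have reg: "regular_space X"
    using compact haus by (rule compact_Hausdorff_imp_regular_space)
  show "Lindelof_space (subtopology X S)"
    unfolding Lindelof_space_subtopology_subset[OF S]
  proof (intro allI impI, rule ccontr)
    fix \<U>
    assume \<U>: "(\<forall>U\<in>\<U>. openin X U) \<and> S \<subseteq> \<Union>\<U>"
      and none: "\<not> (\<exists>\<V>. countable \<V> \<and> \<V> \<subseteq> \<U> \<and> S \<subseteq> \<Union>\<V>)"
    define P :: "(w1 \<Rightarrow> 'a \<times> 'a set) \<Rightarrow> w1 \<Rightarrow> 'a \<times> 'a set \<Rightarrow> bool" where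
      "P f \<alpha> p \<longleftrightarrow> fst p \<in> S \<and> snd p \<in> \<U> \<and> fst p \<in> snd p \<and> (\<forall>\<beta><\<alpha>. fst p \<notin> snd (f \<beta>))" for f \<alpha> p
    have "\<exists>f. \<forall>\<alpha>. P f \<alpha> (f \<alpha>)"
    proof (rule dependent_wf_choice)
      show "wf {(\<beta>, \<alpha> :: w1). \<beta> < \<alpha>}"
        by (rule wf)
      show "P f \<alpha> p = P g \<alpha> p" if "\<And>\<beta>. (\<beta>, \<alpha>) \<in> {(\<beta>, \<alpha>). \<beta> < \<alpha>} \<Longrightarrow> f \<beta> = g \<beta>" for f g \<alpha> p
        using that by (simp add: P_def)
      fix \<alpha> f
      assume IH: "\<And>\<beta>. (\<beta>, \<alpha>) \<in> {(\<beta>, \<alpha>). \<beta> < \<alpha>} \<Longrightarrow> P f \<beta> (f \<beta>)"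
      let ?\<V> = "(\<lambda>\<beta>. snd (f \<beta>)) ` {..<\<alpha>}"
      have "countable ?\<V>" "?\<V> \<subseteq> \<U>"
        using IH countable_lessThan_w1 by (auto simp: P_def)
      then have "\<not> S \<subseteq> \<Union>?\<V>"
        using none by blast
      then obtain x where "x \<in> S" "x \<notin> \<Union>?\<V>"
        by blast
      moreover obtain U where "U \<in> \<U>" "x \<in> U"
        using \<U> \<open>x \<in> S\<close> by blast
      ultimately have "P f \<alpha> (x, U)"
        by (auto simp: P_def)
      then show "\<exists>p. P f \<alpha> p" ..
    qed
    then obtain f where f: "\<And>\<alpha>. P f \<alpha> (f \<alpha>)"
      by auto
    have openU: "openin X (snd (f \<alpha>))" and aU: "fst (f \<alpha>) \<in> snd (f \<alpha>)" for \<alpha>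
      using f[of \<alpha>] \<U> by (auto simp: P_def)
    have "\<forall>\<alpha>. \<exists>V B. openin X V \<and> closedin X B \<and> fst (f \<alpha>) \<in> V \<and> V \<subseteq> B \<and> B \<subseteq> snd (f \<alpha>)"
      using regular_space_nbhd[OF reg openU aU] by simp
    then obtain V B where VB: "\<And>\<alpha>. openin X (V \<alpha>)" "\<And>\<alpha>. closedin X (B \<alpha>)"
        "\<And>\<alpha>. fst (f \<alpha>) \<in> V \<alpha>" "\<And>\<alpha>. V \<alpha> \<subseteq> B \<alpha>" "\<And>\<alpha>. B \<alpha> \<subseteq> snd (f \<alpha>)"
      by metis
    interpret right_separated X "\<lambda>\<alpha>. fst (f \<alpha>)" V B "\<lambda>\<alpha>. snd (f \<alpha>)"
    proof
      show "countably_tight X"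
        by (rule countable_spread_imp_countably_tight[OF compact reg spread])
      show "fst (f \<beta>) \<notin> snd (f \<alpha>)" if "\<alpha> < \<beta>" for \<alpha> \<beta>
        using f[of \<beta>] that by (simp add: P_def)
    qed (use compact haus VB openU in auto)
    show False
      using not_countable_spread[OF MA CH] spread by simp
  qed
qed

section \<open>Hereditary separability\<close>

lemma separable_space_subtopologyI:
  assumes "C \<subseteq> S" "countable C" "S \<subseteq> topspace X" "S \<subseteq> X closure_of C"
  shows "separable_space (subtopology X S)"
  unfolding separable_space_def
proof (intro exI[of _ C] conjI)
  have "S \<inter> C = C"
    using assms(1) by auto
  then show "subtopology X S closure_of C = topspace (subtopology X S)"
    using assms(3,4) by (auto simp: closure_of_subtopology)
qed (use assms in auto)

text \<open>An open \<open>V\<close> has the same closure as \<open>V \<inter> D\<close>, so subsets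
  of \<open>D\<close> generate a base of regular open sets. For countable \<open>D\<close> this base
  has at most continuum many members.\<close>

lemma dense_regular_open_base:
  assumes reg: "regular_space X" and D: "D \<subseteq> topspace X" "X closure_of D = topspace X"
    and "openin X U" "x \<in> U"
  shows "\<exists>E\<subseteq>D. x \<in> X interior_of (X closure_of E) \<and>
    X closure_of (X interior_of (X closure_of E)) \<subseteq> U"
proof -
  obtain V B where V: "openin X V" "closedin X B" "x \<in> V" "V \<subseteq> B" "B \<subseteq> U"
    using regular_space_nbhd[OF assms(1,4,5)] by metis
  have "X closure_of (V \<inter> D) = X closure_of V"
    using V(1) D(2) openin_subset by (intro closure_of_openin_Int_superset) blast
  moreover have "V \<subseteq> X interior_of (X closure_of V)"
    using V(1) openin_subset by (intro interior_of_maximal closure_of_subset) auto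
  moreover have "X closure_of (X interior_of (X closure_of V)) \<subseteq> X closure_of V"
    by (intro closure_of_minimal interior_of_subset closedin_closure_of)
  moreover have "X closure_of V \<subseteq> B"
    using V(2,4) by (intro closure_of_minimal)
  ultimately show ?thesis
    using V(3,5) by (intro exI[of _ "V \<inter> D"]) auto
qed

text \<open>The closure of a left-separated sequence is a compact space with the countable chain condition
  that is the increasing union of \<open>w1\<close> closed sets with empty interior above \<open>\<delta>\<close>; Martin's axiom,
  read as a Baire category theorem, forbids this.\<close>

lemma no_left_separated:
  fixes a :: "w1 \<Rightarrow> 'a"
  assumes MA: "martins_axiom TYPE(real)" and CH: "\<not> continuum_hypothesis"
    and sepX: "separable_space X" and compact: "compact_space X" and haus: "Hausdorff_space X"
    and spread: "countable_spread X"
    and a: "range a \<subseteq> topspace X" "\<And>\<alpha>. a \<alpha> \<notin> X closure_of (a ` {..<\<alpha>})"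
  shows False
proof -
  have reg: "regular_space X"
    using compact haus by (rule compact_Hausdorff_imp_regular_space)
  have tight: "countably_tight X"
    by (rule countable_spread_imp_countably_tight[OF compact reg spread])
  obtain D where D: "countable D" "D \<subseteq> topspace X" "X closure_of D = topspace X"
    using sepX unfolding separable_space_def by blast
  define Z where "Z = X closure_of (range a)"
  define Y where "Y \<alpha> = X closure_of (a ` {..<\<alpha>})" for \<alpha>
  have Y_mono: "Y \<alpha> \<subseteq> Y \<beta>" if "\<alpha> \<le> \<beta>" for \<alpha> \<beta>
    unfolding Y_def using that by (intro closure_of_mono image_mono) auto
  have Z_Y: "\<exists>\<alpha>. z \<in> Y \<alpha>" if z: "z \<in> Z" for z
  proof -
    obtain C where C: "C \<subseteq> range a" "countable C" "z \<in> X closure_of C"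
      using countably_tight_closure_of[OF tight a(1)] z unfolding Z_def by blast
    then obtain N where N: "countable N" "C = a ` N"
      using countable_subset_image[of C a UNIV] by auto
    obtain \<alpha> where "\<And>\<beta>. \<beta> \<in> N \<Longrightarrow> \<beta> < \<alpha>"
      using countable_bounded_w1[OF N(1)] by metis
    then have "C \<subseteq> a ` {..<\<alpha>}"
      unfolding N(2) by auto
    then have "z \<in> Y \<alpha>"
      unfolding Y_def using C(3) closure_of_mono by blast
    then show ?thesis ..
  qed
  \<comment> \<open>These are the open sets on which some \<open>Y \<alpha>\<close> already exhausts
    \<open>Z\<close>. Hereditary Lindelofness covers their union by countably many of them, so one
    \<delta> serves for all: beyond \<open>Y \<delta>\<close> no \<open>Y \<alpha>\<close> has
    interior relative to \<open>Z\<close>.\<close>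
  define \<U> where "\<U> = {Q. openin X Q \<and> (\<exists>\<alpha>. Q \<inter> Z \<subseteq> Y \<alpha>)}"
  have "\<Union>\<U> \<subseteq> topspace X"
    unfolding \<U>_def using openin_subset by fast
  moreover have "hereditarily Lindelof_space X"
    by (rule countable_spread_hereditarily_Lindelof[OF MA CH compact haus spread])
  ultimately have "Lindelof_space (subtopology X (\<Union>\<U>))"
    by (simp add: hereditarily_def)
  moreover have "(\<forall>U\<in>\<U>. openin X U) \<and> \<Union>\<U> \<subseteq> \<Union>\<U>"
    by (simp add: \<U>_def)
  ultimately obtain \<V> where \<V>: "countable \<V>" "\<V> \<subseteq> \<U>" "\<Union>\<U> \<subseteq> \<Union>\<V>"
    unfolding Lindelof_space_subtopology_subset[OF \<open>\<Union>\<U> \<subseteq> topspace X\<close>] by metis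
  have "\<forall>Q\<in>\<V>. \<exists>\<alpha>. Q \<inter> Z \<subseteq> Y \<alpha>"
    using \<V>(2) unfolding \<U>_def by auto
  then obtain h where h: "\<forall>Q\<in>\<V>. Q \<inter> Z \<subseteq> Y (h Q)"
    unfolding bchoice_iff by auto
  have "countable (h ` \<V>)"
    using \<V>(1) by simp
  then obtain \<delta> where \<delta>: "\<And>\<alpha>. \<alpha> \<in> h ` \<V> \<Longrightarrow> \<alpha> < \<delta>"
    using countable_bounded_w1 by metis
  have Y\<delta>: "Q \<inter> Z \<subseteq> Y \<delta>" if "openin X Q" "Q \<inter> Z \<subseteq> Y \<alpha>" for Q \<alpha>
  proof
    fix x
    assume x: "x \<in> Q \<inter> Z"
    have "Q \<in> \<U>"
      using that unfolding \<U>_def by auto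
    then obtain Q' where Q': "Q' \<in> \<V>" "x \<in> Q'"
      using x \<V>(3) by blast
    then have "x \<in> Y (h Q')"
      using h x by blast
    moreover have "Y (h Q') \<subseteq> Y \<delta>"
      using \<delta>[of "h Q'"] Q'(1) by (intro Y_mono) simp
    ultimately show "x \<in> Y \<delta>"
      by blast
  qed
  define K where "K = Z - Y \<delta>"
  define \<B> where "\<B> = (\<lambda>E. X interior_of (X closure_of E)) ` Pow D"
  define P where "P = {W \<in> \<B>. W \<inter> K \<noteq> {}}"
  define r where "r = {(W, W'). W \<in> P \<and> W' \<in> P \<and> W \<subseteq> W'}"
  define E where "E \<alpha> = {W \<in> P. X closure_of W \<inter> Y \<alpha> = {}}" for \<alpha>
  have openB: "openin X W" if "W \<in> \<B>" for W
    using that by (auto simp: \<B>_def)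
  have base: "\<exists>W\<in>\<B>. x \<in> W \<and> X closure_of W \<subseteq> U" if "openin X U" "x \<in> U" for x U
    using dense_regular_open_base[OF reg D(2,3) that] unfolding \<B>_def by auto
  have B_closure: "W \<subseteq> X closure_of W" if "W \<in> \<B>" for W
    using openB[OF that] openin_subset by (intro closure_of_subset) auto
  have "a \<delta> \<in> K"
    using a closure_of_subset[OF a(1)] unfolding K_def Z_def Y_def by auto
  have "a \<delta> \<in> topspace X"
    using a(1) by auto
  then obtain W0 where "W0 \<in> \<B>" "a \<delta> \<in> W0"
    using base[OF openin_topspace] by blast
  then have "W0 \<in> P"
    using \<open>a \<delta> \<in> K\<close> by (auto simp: P_def)
  then have "P \<noteq> {}"
    by blast
  moreover have "partial_order_on P r"
    by (auto simp: partial_order_on_def preorder_on_def refl_on_def trans_def antisym_def r_def)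
  moreover have "countable_chain_condition P r"
    unfolding countable_chain_condition_def
  proof (intro allI impI)
    fix \<A>
    assume \<A>: "\<A> \<subseteq> P" and anti: "\<forall>p\<in>\<A>. \<forall>q\<in>\<A>. p \<noteq> q \<longrightarrow> \<not> forcing_compatible P r p q"
    \<comment> \<open>Incompatible conditions are disjoint on \<open>K\<close>. One point of
      \<open>K\<close> from each member of an antichain therefore gives a discrete set, and
      countable spread yields the chain condition.\<close>
    have disj: "W = W'" if W: "W \<in> \<A>" "W' \<in> \<A>" "x \<in> W" "x \<in> W'" "x \<in> K" for W W' x
    proof (rule ccontr)
      assume "W \<noteq> W'"
      have WB: "W \<in> \<B>" "W' \<in> \<B>" "W \<in> P" "W' \<in> P"
        using W \<A> by (auto simp: P_def)
      then obtain W'' where W'': "W'' \<in> \<B>" "x \<in> W''" "X closure_of W'' \<subseteq> W \<inter> W'"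
        using base[of "W \<inter> W'" x] openB W by auto
      then have "W'' \<subseteq> W \<inter> W'"
        using B_closure by blast
      moreover have "W'' \<in> P"
        using W'' W(5) by (auto simp: P_def)
      ultimately have "forcing_compatible P r W W'"
        unfolding forcing_compatible_def using WB by (intro bexI[of _ W'']) (auto simp: r_def)
      then show False
        using anti W \<open>W \<noteq> W'\<close> by simp
    qed
    have "\<forall>W\<in>\<A>. \<exists>x. x \<in> W \<and> x \<in> K"
      using \<A> by (auto simp: P_def)
    then obtain x where x: "\<forall>W\<in>\<A>. x W \<in> W \<and> x W \<in> K"
      unfolding bchoice_iff by auto
    have inj: "inj_on x \<A>"
    proof (rule inj_onI)
      fix W W'
      assume W: "W \<in> \<A>" "W' \<in> \<A>" "x W = x W'"
      then have "x W \<in> W" "x W \<in> W'" "x W \<in> K"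
        using x by metis+
      then show "W = W'"
        by (rule disj[OF W(1,2)])
    qed
    have "countable (x ` \<A>)"
    proof (rule countable_spreadD[OF spread])
      show "x ` \<A> \<subseteq> topspace X"
        using x closure_of_subset_topspace[of X "range a"] unfolding K_def Z_def by blast
      fix z
      assume "z \<in> x ` \<A>"
      then obtain W where W: "W \<in> \<A>" "z = x W"
        by blast
      have "W \<inter> x ` \<A> = {z}"
      proof
        show "{z} \<subseteq> W \<inter> x ` \<A>"
          using W x by blast
        show "W \<inter> x ` \<A> \<subseteq> {z}"
        proof
          fix y
          assume "y \<in> W \<inter> x ` \<A>"
          then obtain W' where W': "W' \<in> \<A>" "y = x W'" "y \<in> W"
            by blast
          have "W = W'"
            by (rule disj[OF W(1) W'(1,3)]) (use x W' in auto)
          then show "y \<in> {z}"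
            using W(2) W'(2) by simp
        qed
      qed
      moreover have "openin X W"
        using W(1) \<A> openB by (auto simp: P_def)
      ultimately show "\<exists>U. openin X U \<and> U \<inter> x ` \<A> = {z}"
        by (intro exI[of _ W] conjI)
    qed
    then show "countable \<A>"
      using inj by (rule countable_image_inj_on)
  qed
  moreover have "P \<lesssim> (UNIV :: real set)"
  proof -
    have "P \<subseteq> \<B>"
      by (auto simp: P_def)
    then have "P \<lesssim> \<B>"
      by (rule subset_imp_lepoll)
    also have "\<B> \<lesssim> Pow D"
      unfolding \<B>_def by (rule image_lepoll)
    also have "\<dots> \<lesssim> (UNIV :: real set)"
      by (rule Pow_countable_lepoll_reals[OF D(1)])
    finally show ?thesis .
  qed
  moreover have "forcing_dense P r (E \<alpha>)" for \<alpha>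
  proof -
    have "\<exists>W'\<in>E \<alpha>. (W', W) \<in> r" if "W \<in> P" for W
    proof -
      have W: "openin X W" "W \<inter> K \<noteq> {}"
        using that openB by (auto simp: P_def)
      \<comment> \<open>If \<open>Y \<alpha>\<close> contained the trace of this set on
        \<open>Z\<close>, then so would \<open>Y \<delta>\<close> by the choice of \<delta>; the
        trace would be empty, although \<open>W\<close> meets \<open>K\<close>.\<close>
      have "openin X (W - Y \<delta>)"
        using W(1) by (simp add: openin_diff Y_def)
      moreover have "\<not> (W - Y \<delta>) \<inter> Z \<subseteq> Y \<delta>"
        using W(2) unfolding K_def by blast
      ultimately have "\<not> (W - Y \<delta>) \<inter> Z \<subseteq> Y \<alpha>"
        using Y\<delta> by blast
      then obtain x where x: "x \<in> W" "x \<in> K" "x \<notin> Y \<alpha>"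
        unfolding K_def by blast
      have "openin X (W - Y \<alpha>)"
        using W(1) by (simp add: openin_diff Y_def)
      then obtain W' where W': "W' \<in> \<B>" "x \<in> W'" "X closure_of W' \<subseteq> W - Y \<alpha>"
        using base[of "W - Y \<alpha>" x] x by auto
      moreover have "W' \<in> P"
        using W' x(2) by (auto simp: P_def)
      moreover have "W' \<subseteq> W"
        using W' B_closure by blast
      ultimately show ?thesis
        using that by (intro bexI[of _ W']) (auto simp: E_def r_def)
    qed
    then show ?thesis
      by (auto simp: forcing_dense_def E_def)
  qed
  ultimately obtain G where G: "forcing_filter P r G" and GE: "\<And>\<alpha>. \<alpha> \<in> UNIV \<Longrightarrow> G \<inter> E \<alpha> \<noteq> {}"
    using martins_axiom_generic[OF MA, of P r UNIV E] w1_lesspoll_reals[OF CH] by metis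
  have G_fin: "\<exists>s\<in>G. \<forall>W\<in>F. s \<subseteq> W" if "finite F" "F \<subseteq> G" for F
    using that
  proof (induction F)
    case empty
    then show ?case
      using G by (auto simp: forcing_filter_def)
  next
    case (insert W F)
    then obtain s where s: "s \<in> G" "\<forall>W\<in>F. s \<subseteq> W"
      by auto
    have "\<exists>t\<in>G. (t, s) \<in> r \<and> (t, W) \<in> r"
      using G s insert.prems by (simp add: forcing_filter_def)
    then obtain t where "t \<in> G" "t \<subseteq> s" "t \<subseteq> W"
      by (auto simp: r_def)
    then show ?case
      using s(2) by (intro bexI[of _ t]) auto
  qed
  have G_P: "W \<in> P" if "W \<in> G" for W
    using G that by (auto simp: forcing_filter_def)
  \<comment> \<open>Compactness supplies a point \<open>z\<close> of \<open>Z\<close> in the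
    closures of all generic conditions. It belongs to some \<open>Y \<alpha>\<close>, whereas a
    generic condition in \<open>E \<alpha>\<close> has closure missing
    \<open>Y \<alpha>\<close>.\<close>
  let ?\<F> = "(\<lambda>W. X closure_of W \<inter> Z) ` G"
  have "\<Inter>?\<F> \<noteq> {}"
  proof (rule compact_space_fip[THEN iffD1, OF compact, THEN spec, THEN mp], intro conjI ballI allI impI)
    show "closedin X C" if "C \<in> ?\<F>" for C
      using that by (auto simp: Z_def)
    fix F
    assume "finite F \<and> F \<subseteq> ?\<F>"
    then obtain N where N: "finite N" "N \<subseteq> G" "F = (\<lambda>W. X closure_of W \<inter> Z) ` N"
      by (meson finite_subset_image)
    obtain s where s: "s \<in> G" "\<forall>W\<in>N. s \<subseteq> W"
      using G_fin[OF N(1,2)] by blast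
    obtain x where x: "x \<in> s" "x \<in> K"
      using G_P[OF s(1)] by (auto simp: P_def)
    have "x \<in> X closure_of W \<inter> Z" if "W \<in> N" for W
    proof -
      have "W \<in> \<B>"
        using G_P that N(2) by (auto simp: P_def)
      then show ?thesis
        using B_closure x s(2) that unfolding K_def by blast
    qed
    then have "x \<in> \<Inter>F"
      unfolding N(3) by blast
    then show "\<Inter>F \<noteq> {}"
      by (metis empty_iff)
  qed
  then obtain z where "z \<in> \<Inter>?\<F>"
    by (meson ex_in_conv)
  then have z: "z \<in> X closure_of W \<inter> Z" if "W \<in> G" for W
    using that by (rule InterD[OF _ imageI])
  have "G \<noteq> {}"
    using G by (simp add: forcing_filter_def)
  then have "z \<in> Z"
    using z by auto
  then obtain \<alpha> where "z \<in> Y \<alpha>"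
    using Z_Y by auto
  moreover obtain W where "W \<in> G" "W \<in> E \<alpha>"
    using GE[of \<alpha>] by auto
  ultimately show False
    using z[of W] by (auto simp: E_def)
qed

text \<open>If \<open>S\<close> is not separable, no countable initial segment of a sequence in
  \<open>S\<close> is dense in it, so recursion always finds a next point outside the closure: a
  left-separated sequence.\<close>

theorem countable_spread_hereditarily_separable:
  assumes MA: "martins_axiom TYPE(real)" and CH: "\<not> continuum_hypothesis"
    and sepX: "separable_space X" and compact: "compact_space X" and haus: "Hausdorff_space X"
    and spread: "countable_spread X"
  shows "hereditarily separable_space X"
  unfolding hereditarily_def
proof (intro allI impI, rule ccontr)
  fix S
  assume S: "S \<subseteq> topspace X" and not_sep: "\<not> separable_space (subtopology X S)"
  define P where "P f \<alpha> x \<longleftrightarrow> x \<in> S \<and> x \<notin> X closure_of (f ` {..<\<alpha>})" for f :: "w1 \<Rightarrow> 'a" and \<alpha> x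
  have "\<exists>f. \<forall>\<alpha>. P f \<alpha> (f \<alpha>)"
  proof (rule dependent_wf_choice)
    show "wf {(\<beta>, \<alpha> :: w1). \<beta> < \<alpha>}"
      by (rule wf)
    show "P f \<alpha> x = P g \<alpha> x" if "\<And>\<beta>. (\<beta>, \<alpha>) \<in> {(\<beta>, \<alpha>). \<beta> < \<alpha>} \<Longrightarrow> f \<beta> = g \<beta>" for f g \<alpha> x
    proof -
      have "f ` {..<\<alpha>} = g ` {..<\<alpha>}"
        using that by (intro image_cong) auto
      then show ?thesis
        by (simp add: P_def)
    qed
    fix \<alpha> f
    assume IH: "\<And>\<beta>. (\<beta>, \<alpha>) \<in> {(\<beta>, \<alpha>). \<beta> < \<alpha>} \<Longrightarrow> P f \<beta> (f \<beta>)"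
    have "f ` {..<\<alpha>} \<subseteq> S" "countable (f ` {..<\<alpha>})"
      using IH countable_lessThan_w1 by (auto simp: P_def)
    then have "\<not> S \<subseteq> X closure_of (f ` {..<\<alpha>})"
      using separable_space_subtopologyI[of "f ` {..<\<alpha>}" S X] not_sep S by blast
    then show "\<exists>x. P f \<alpha> x"
      by (auto simp: P_def)
  qed
  then obtain f where f: "\<And>\<alpha>. P f \<alpha> (f \<alpha>)"
    by auto
  have "range f \<subseteq> topspace X"
    using f S by (auto simp: P_def)
  moreover have "f \<alpha> \<notin> X closure_of (f ` {..<\<alpha>})" for \<alpha>
    using f by (simp add: P_def)
  ultimately show False
    by (rule no_left_separated[OF MA CH sepX compact haus spread])
qed

theorem corollary2p8:
  fixes X :: "'a topology"
  assumes "martins_axiom TYPE(real)"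
    and "\<not> continuum_hypothesis"
    and "separable_space X"
    and "hereditarily_supercompact_space X"
    and "regular_space X"
    and "Hausdorff_space X"
  shows "hereditarily separable_space X \<and> hereditarily Lindelof_space X"
proof -
  have "supercompact_space (subtopology X (topspace X))"
    using assms(4) unfolding hereditarily_supercompact_space_def by blast
  then have compact: "compact_space X"
    by (simp add: supercompact_imp_compact_space)
  have spread: "countable_spread X"
    by (rule hereditarily_supercompact_countable_spread[OF assms])
  show ?thesis
    using countable_spread_hereditarily_separable[OF assms(1-3) compact assms(6) spread]
      countable_spread_hereditarily_Lindelof[OF assms(1,2) compact assms(6) spread] by (rule conjI)
qed

end
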